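(* The ordinary generating function $F(x)=\sum_{n\ge 0}|\mathfrak D^1_{2n}(2413,3142)|\,x^n$ is given by \[ F(x)=\frac{3-\sqrt{1-8x}}{2(1+x)}=\frac{1}{3}C\!\left(\frac{2(1+x)}{9}\right)=\frac{1+2xC(2x)}{1+x}=\frac{1}{1-xC(2x)}, \] and consequently, for every $n\ge 0$, \[ |\mathfrak D^1_{2n}(2413,3142)|=(-1)^n+\sum_{k=1}^{n}(-1)^{n-k}2^{k}C_{k-1}=\sum_{k=0}^{n-1}\frac{n-k}{n+k}\binom{n+k}{n}2^k+\delta_{n=0}, \] where $\delta_{n=0}$ is $1$ if $n=0$ and $0$ otherwise.
   Context: A Dumont permutation of the first kind of length $2n$ is a permutation $\pi\in\mathfrak S_{2n}$ such that for every $i=1,\dots,2n$: if $\pi(i)$ is even then $i<2n$ and $\pi(i)>\pi(i+1)$; if $\pi(i)$ is odd then $i=2n$ or $\pi(i)<\pi(i+1)$. $\mathfrak D^1_{2n}$ denotes the set of these ($\mathfrak D^1_0$ consists of the empty permutation). A permutation $\sigma$ contains a pattern $\tau\in\mathfrak S_k$ if some subsequence $(\sigma(i_1),\dots,\sigma(i_k))$, $i_1<\dots<i_k$, is order-isomorphic to $\tau$; otherwise $\sigma$ avoids $\tau$. $\mathfrak D^1_{2n}(T)$ denotes the set of permutations in $\mathfrak D^1_{2n}$ avoiding every pattern in $T$. $C_m=\frac{1}{m+1}\binom{2m}{m}$ is the $m$th Catalan number and $C(x)=\frac{1-\sqrt{1-4x}}{2x}=\sum_{m\ge0}C_mx^m$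 its ordinary generating function.
   Formalization: The factor 1/3 in front of C(2(1+x)/9) is corrected to 2/3: at x=0 one has C(2/9)=3/2, so 1/3 would give 1/2, while F(0)=1. The generating function identities are stated for real |x|<1/8. *)

theory Defs
  imports Complex_Main "HOL-Combinatorics.Permutations"
begin

definition dumont1 :: "nat \<Rightarrow> (nat \<Rightarrow> nat) set" where
  "dumont1 n = {\<pi>. \<pi> permutes {1..2*n} \<and>
     (\<forall>i\<in>{1..2*n}.
        (even (\<pi> i) \<longrightarrow> i < 2*n \<and> \<pi> i > \<pi> (i+1)) \<and>
        (odd (\<pi> i) \<longrightarrow> i = 2*n \<or> \<pi> i < \<pi> (i+1)))}"

text \<open>sigma, viewed as the word sigma(1)...sigma(m), contains the pattern tau
  (given as the word tau(1)...tau(k) of a permutation of {1..k}).\<close>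
definition contains_pattern :: "(nat \<Rightarrow> nat) \<Rightarrow> nat \<Rightarrow> nat list \<Rightarrow> bool" where
  "contains_pattern \<sigma> m \<tau> \<longleftrightarrow>
     (\<exists>idx :: nat \<Rightarrow> nat. strict_mono_on {0..<length \<tau>} idx \<and>
        (\<forall>j<length \<tau>. idx j \<in> {1..m}) \<and>
        (\<forall>a<length \<tau>. \<forall>b<length \<tau>. \<sigma> (idx a) < \<sigma> (idx b) \<longleftrightarrow> \<tau> ! a < \<tau> ! b))"

definition avoids_all :: "(nat \<Rightarrow> nat) \<Rightarrow> nat \<Rightarrow> nat list set \<Rightarrow> bool" where
  "avoids_all \<sigma> m T \<longleftrightarrow> (\<forall>\<tau>\<in>T. \<not> contains_pattern \<sigma> m \<tau>)"

definition dumont1_av :: "nat \<Rightarrow> nat list set \<Rightarrow> (nat \<Rightarrow> nat) set" where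
  "dumont1_av n T = {\<pi> \<in> dumont1 n. avoids_all \<pi> (2*n) T}"

definition catalan :: "nat \<Rightarrow> real" where
  "catalan m = real (2*m choose m) / real (m+1)"

text \<open>C(x) = (1 - sqrt(1-4x))/(2x), with its value C(0) = C_0 = 1 at x = 0.\<close>
definition catalan_gf :: "real \<Rightarrow> real" where
  "catalan_gf x = (if x = 0 then 1 else (1 - sqrt (1 - 4*x)) / (2*x))"

end

theory Submission
  imports Defs
    "HOL-Analysis.Generalised_Binomial_Theorem"
    "HOL-Computational_Algebra.Formal_Power_Series"
begin

text \<open>
  A permutation avoiding 2413 and 3142 of length at least 2 is a direct sum or a skew sum. Let
  \<open>f n\<close> count the Dumont permutations in question and \<open>g n\<close> the sum-irreducible ones. By parity
  the sum components of a Dumont permutation are Dumont permutations of even length, so splitting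
  off the first one gives \<open>f n = (\<Sum>k=1..n. g k * f (n - k))\<close>. The first skew component of a
  sum-irreducible one is either the single letter \<open>2*n\<close>, and then the last letter is \<open>2*n-1\<close> and
  the letters in between form an arbitrary Dumont permutation, or it is the complement of a
  sum-irreducible Dumont permutation, followed by an arbitrary nonempty one. Hence
  \<open>g n = f (n - 1) + (\<Sum>k=1..<n. g k * f (n - k))\<close>. For the generating functions this means
  \<open>F = 1 + G F\<close> and \<open>(1 + x) F = 1 + 2 G\<close>, so \<open>G = x + 2 G\<^sup>2\<close>, that is \<open>G = x C(2 x)\<close>.
\<close>

subsection \<open>Dumont words and separable words\<close>

text \<open>The obstacle is that the Dumont condition does not survive cutting: the last letter of a
  left factor loses the successor to which its parity refers. In a direct sum that successor is
  larger, so the letter is odd and the left factor is again Dumont. In a skew sum it is smaller, so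
  the letter is even and the left factor is Dumont except at its end. Replacing \<open>x\<close> by
  \<open>c - x\<close> with \<open>c\<close> odd reverses parity and order together, which exchanges
  the two kinds of factor, and it also exchanges 2413 with 3142; hence skew components are counted
  by the same numbers as sum components.

  Since \<open>G = x + 2 G^2\<close> reads \<open>(1 - 4 G)^2 = 1 - 8 x\<close>, the binomial series
  with exponent 1/2 yields both the coefficients of \<open>G\<close> and its value for real
  \<open>x\<close> with absolute value below 1/8. The two finite sums are not obtained by extracting
  coefficients: both satisfy \<open>f (n+1) = 2^(n+1) C_n - f n\<close>.\<close>

text \<open>Dumont words for \<open>b = True\<close>; for \<open>b = False\<close> the final letter has to be even instead of odd.
  The flag is what makes the condition decompose over concatenations.\<close>

fun dumont_word :: "bool \<Rightarrow> nat list \<Rightarrow> bool" where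
  "dumont_word b [] = True"
| "dumont_word b [x] = (odd x = b)"
| "dumont_word b (x # y # zs) = ((odd x = (x < y)) \<and> dumont_word b (y # zs))"

text \<open>The two disjuncts are 2413 and 3142. The letter type is kept general because the
  splitting argument passes to integers in order to negate letters.\<close>

definition separable :: "'a::linorder list \<Rightarrow> bool" where
  "separable w \<longleftrightarrow> \<not> (\<exists>i j k l. i < j \<and> j < k \<and> k < l \<and> l < length w \<and>
     (w!k < w!i \<and> w!i < w!l \<and> w!l < w!j \<or> w!j < w!l \<and> w!l < w!i \<and> w!i < w!k))"

lemma separableD:
  assumes "separable w" "i < j" "j < k" "k < l" "l < length w"
  shows "\<not> (w!k < w!i \<and> w!i < w!l \<and> w!l < w!j \<or> w!j < w!l \<and> w!l < w!i \<and> w!i < w!k)"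
proof
  assume "w!k < w!i \<and> w!i < w!l \<and> w!l < w!j \<or> w!j < w!l \<and> w!l < w!i \<and> w!i < w!k"
  with assms(2-5) have "\<not> separable w"
    unfolding separable_def not_not by (intro exI conjI)
  with assms(1) show False by contradiction
qed

definition below :: "'a::linorder list \<Rightarrow> 'a list \<Rightarrow> bool" where
  "below u v \<longleftrightarrow> (\<forall>x\<in>set u. \<forall>y\<in>set v. x < y)"

definition sum_irreducible :: "'a::linorder list \<Rightarrow> bool" where
  "sum_irreducible w \<longleftrightarrow> (\<forall>u v. w = u @ v \<and> u \<noteq> [] \<and> v \<noteq> [] \<longrightarrow> \<not> below u v)"

definition skew_irreducible :: "'a::linorder list \<Rightarrow> bool" where
  "skew_irreducible w \<longleftrightarrow> (\<forall>u v. w = u @ v \<and> u \<noteq> [] \<and> v \<noteq> [] \<longrightarrow> \<not> below v u)"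

text \<open>Of \<open>v\<close>, the letters of \<open>u\<close> see only \<open>hd v\<close>, and
  only through the last letter of \<open>u\<close>: that letter must be odd exactly when the step
  across the cut is an ascent, so this truth value becomes the flag of \<open>u\<close>.\<close>

lemma dumont_word_append:
  assumes "u \<noteq> []" "v \<noteq> []"
  shows "dumont_word b (u @ v) \<longleftrightarrow> dumont_word (last u < hd v) u \<and> dumont_word b v"
  using assms
proof (induction u rule: induct_list012)
  case (2 x)
  then show ?case by (cases v) auto
next
  case (3 x y zs)
  then show ?case by auto
qed auto

section \<open>Parity of extremal letters\<close>

text \<open>A letter that is not last is followed by a larger or smaller one according to its
  parity. Applied to a minimum or maximum, this fixes its parity or forces it to the end.\<close>

lemma dumont_word_occurrence:
  assumes "dumont_word b w" "distinct w" "x \<in> set w"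
  shows "(odd x = b \<and> last w = x) \<or> (\<exists>y\<in>set w. if odd x then x < y else y < x)"
proof -
  obtain p q where w: "w = p @ x # q" using assms(3) by (meson split_list)
  have d: "dumont_word b (x # q)"
    using assms(1) w dumont_word_append[of p "x # q" b] by (cases p) auto
  show ?thesis
  proof (cases q)
    case Nil
    then show ?thesis using d w by auto
  next
    case (Cons y q')
    then have "x \<noteq> y" "odd x = (x < y)" using d assms(2) w by auto
    then show ?thesis using w Cons by auto
  qed
qed

lemma dumont_word_min_odd:
  assumes "dumont_word True w" "distinct w" "x \<in> set w" "\<And>y. y \<in> set w \<Longrightarrow> x \<le> y"
  shows "odd x"
  using dumont_word_occurrence[OF assms(1-3)] assms(4) by (force split: if_splits)

lemma dumont_word_min_even_last:
  assumes "dumont_word b w" "distinct w" "x \<in> set w" "\<And>y. y \<in> set w \<Longrightarrow> x \<le> y" "even x"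
  shows "last w = x"
  using dumont_word_occurrence[OF assms(1-3)] assms(4,5) by (force split: if_splits)

lemma dumont_word_max_odd_last:
  assumes "dumont_word b w" "distinct w" "x \<in> set w" "\<And>y. y \<in> set w \<Longrightarrow> y \<le> x" "odd x"
  shows "last w = x"
  using dumont_word_occurrence[OF assms(1-3)] assms(4,5) by (force split: if_splits)

lemma dumont_word_map_shift:
  "even c \<Longrightarrow> dumont_word b (map (\<lambda>x. x + c) w) = dumont_word b w"
  by (induction w rule: induct_list012) auto

text \<open>With \<open>c\<close> odd, parity and order are reversed together, so the condition on
  neighbours is kept; the last letter has no neighbour to compensate, so the flag flips.\<close>

lemma dumont_word_map_complement:
  assumes "odd c" "distinct w" "\<And>x. x \<in> set w \<Longrightarrow> x \<le> c"
  shows "dumont_word b (map (\<lambda>x. c - x) w) = dumont_word (\<not> b) w"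
  using assms
proof (induction w rule: induct_list012)
  case (3 x y zs)
  then have "x \<le> c" "y \<le> c" "x \<noteq> y" by auto
  then have "odd (c - x) = even x" "c - x < c - y \<longleftrightarrow> \<not> x < y"
    using \<open>odd c\<close> by (auto simp: even_diff_nat)
  then show ?case using 3 by auto
qed (auto simp: even_diff_nat)

section \<open>Separable words: closure properties and splitting\<close>

lemma below_append [simp]:
  "below (u @ u') v \<longleftrightarrow> below u v \<and> below u' v"
  "below u (v @ v') \<longleftrightarrow> below u v \<and> below u v'"
  by (auto simp: below_def)

lemma below_nth:
  "below u v \<longleftrightarrow> (\<forall>i<length u. \<forall>j<length v. u!i < v!j)"
  unfolding below_def by (metis in_set_conv_nth)

lemma separable_appendD:
  assumes "separable (u @ v)"
  shows "separable u" "separable v"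
proof -
  show "separable u"
    unfolding separable_def
  proof clarify
    fix i j k l
    assume *: "i < j" "j < k" "k < l" "l < length u"
      and "u!k < u!i \<and> u!i < u!l \<and> u!l < u!j \<or> u!j < u!l \<and> u!l < u!i \<and> u!i < u!k"
    then have "let w = u @ v in w!k < w!i \<and> w!i < w!l \<and> w!l < w!j \<or> w!j < w!l \<and> w!l < w!i \<and> w!i < w!k"
      by (simp add: nth_append)
    then show False
      using separableD[OF assms *(1-3)] *(4) by (simp add: Let_def)
  qed
  show "separable v"
    unfolding separable_def
  proof clarify
    fix i j k l
    assume *: "i < j" "j < k" "k < l" "l < length v"
      and P: "v!k < v!i \<and> v!i < v!l \<and> v!l < v!j \<or> v!j < v!l \<and> v!l < v!i \<and> v!i < v!k"
    define i' j' k' l' where defs: "i' = length u + i" "j' = length u + j" "k' = length u + k" "l' = length u + l"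
    have "i' < j'" "j' < k'" "k' < l'" "l' < length (u @ v)" using * defs by auto
    moreover have "let w = u @ v in w!k' < w!i' \<and> w!i' < w!l' \<and> w!l' < w!j' \<or> w!j' < w!l' \<and> w!l' < w!i' \<and> w!i' < w!k'"
      using P unfolding defs by (simp add: nth_append)
    ultimately show False using separableD[OF assms] unfolding Let_def by meson
  qed
qed

text \<open>In an occurrence straddling the cut, the first letter lies in \<open>u\<close> and the
  last in \<open>v\<close>, and comparing them decides between 2413 and 3142. The remaining
  inequalities then put the second letter into \<open>v\<close> but the third into
  \<open>u\<close>.\<close>

lemma separable_append:
  assumes "separable u" "separable v" "below u v \<or> below v u"
  shows "separable (u @ v)"
  unfolding separable_def
proof clarify
  fix i j k l
  let ?w = "u @ v" and ?m = "length u"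
  assume *: "i < j" "j < k" "k < l" "l < length ?w"
    and P: "?w!k < ?w!i \<and> ?w!i < ?w!l \<and> ?w!l < ?w!j \<or> ?w!j < ?w!l \<and> ?w!l < ?w!i \<and> ?w!i < ?w!k"
  consider "l < ?m" | "?m \<le> i" | "i < ?m" "?m \<le> l" by linarith
  then show False
  proof cases
    case 1
    then have "u!k < u!i \<and> u!i < u!l \<and> u!l < u!j \<or> u!j < u!l \<and> u!l < u!i \<and> u!i < u!k"
      using P * by (simp add: nth_append)
    then show False using separableD[OF assms(1) *(1-3) 1] by contradiction
  next
    case 2
    define i' j' k' l' where defs: "i' = i - ?m" "j' = j - ?m" "k' = k - ?m" "l' = l - ?m"
    have "v!k' < v!i' \<and> v!i' < v!l' \<and> v!l' < v!j' \<or> v!j' < v!l' \<and> v!l' < v!i' \<and> v!i' < v!k'"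
      using P * 2 unfolding defs by (simp add: nth_append)
    moreover have "i' < j'" "j' < k'" "k' < l'" "l' < length v" using * 2 unfolding defs by auto
    ultimately show False using separableD[OF assms(2)] by meson
  next
    case 3
    from assms(3) show False
    proof
      assume "below u v"
      then have lt: "?w!p < ?w!q" if "p < ?m" "?m \<le> q" "q < length ?w" for p q
        using that unfolding below_nth by (simp add: nth_append)
      have "?w!i < ?w!l" using lt 3 * by blast
      then have p: "?w!k < ?w!i" "?w!l < ?w!j" using P by auto
      then have "?m \<le> j" using lt[of j l] 3 * by force
      then show False using lt[of i k] p(1) 3 * by force
    next
      assume "below v u"
      then have lt: "?w!q < ?w!p" if "p < ?m" "?m \<le> q" "q < length ?w" for p q
        using that unfolding below_nth by (simp add: nth_append)
      have "?w!l < ?w!i" using lt 3 * by blast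
      then have p: "?w!j < ?w!l" "?w!i < ?w!k" using P by auto
      then have "?m \<le> j" using lt[of j l] 3 * by force
      then show False using lt[of i k] p(2) 3 * by force
    qed
  qed
qed

lemma separable_map_strict_mono:
  assumes "\<And>x y. x \<in> set w \<Longrightarrow> y \<in> set w \<Longrightarrow> f x < f y \<longleftrightarrow> x < y"
  shows "separable (map f w) = separable w"
proof -
  have *: "map f w ! a < map f w ! b \<longleftrightarrow> w!a < w!b" if "a < length w" "b < length w" for a b
    using that assms by simp
  have "(map f w!k < map f w!i \<and> map f w!i < map f w!l \<and> map f w!l < map f w!j \<or>
         map f w!j < map f w!l \<and> map f w!l < map f w!i \<and> map f w!i < map f w!k) \<longleftrightarrow>
        (w!k < w!i \<and> w!i < w!l \<and> w!l < w!j \<or> w!j < w!l \<and> w!l < w!i \<and> w!i < w!k)"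
    if "i < j" "j < k" "k < l" "l < length w" for i j k l
  proof -
    have "i < length w" "j < length w" "k < length w" using that by linarith+
    then show ?thesis by (simp only: * that)
  qed
  then show ?thesis unfolding separable_def length_map by blast
qed

text \<open>Order reversal turns 2413 into 3142 and vice versa, so the two disjuncts are merely
  exchanged.\<close>

lemma separable_map_strict_antimono:
  assumes "\<And>x y. x \<in> set w \<Longrightarrow> y \<in> set w \<Longrightarrow> f x < f y \<longleftrightarrow> y < x"
  shows "separable (map f w) = separable w"
proof -
  have *: "map f w ! a < map f w ! b \<longleftrightarrow> w!b < w!a" if "a < length w" "b < length w" for a b
    using that assms by simp
  have "(map f w!k < map f w!i \<and> map f w!i < map f w!l \<and> map f w!l < map f w!j \<or>
         map f w!j < map f w!l \<and> map f w!l < map f w!i \<and> map f w!i < map f w!k) \<longleftrightarrow>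
        (w!k < w!i \<and> w!i < w!l \<and> w!l < w!j \<or> w!j < w!l \<and> w!l < w!i \<and> w!i < w!k)"
    if "i < j" "j < k" "k < l" "l < length w" for i j k l
  proof -
    have "i < length w" "j < length w" "k < length w" using that by linarith+
    then have "?thesis \<longleftrightarrow>
        (w!i < w!k \<and> w!l < w!i \<and> w!j < w!l \<or> w!l < w!j \<and> w!i < w!l \<and> w!k < w!i) =
        (w!k < w!i \<and> w!i < w!l \<and> w!l < w!j \<or> w!j < w!l \<and> w!l < w!i \<and> w!i < w!k)"
      by (simp only: * that)
    then show ?thesis by blast
  qed
  then show ?thesis unfolding separable_def length_map by blast
qed

text \<open>Lets an occurrence be read off a factorization of the word, without index
  arithmetic.\<close>

lemma separable_sublistD:
  assumes "separable (p @ a # q @ b # r @ c # s @ d # t)"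
  shows "\<not> (c < a \<and> a < d \<and> d < b \<or> b < d \<and> d < a \<and> a < c)"
proof -
  let ?w = "p @ a # q @ b # r @ c # s @ d # t"
  let ?i = "length p" let ?j = "?i + 1 + length q" let ?k = "?j + 1 + length r" let ?l = "?k + 1 + length s"
  have "?w ! ?i = a" by simp
  moreover have "?w ! ?j = b" by (simp add: nth_append)
  moreover have "?w ! ?k = c" by (simp add: nth_append)
  moreover have "?w ! ?l = d" by (simp add: nth_append)
  ultimately show ?thesis using separableD[OF assms, of ?i ?j ?k ?l] by simp
qed

text \<open>For a shortest bottom part \<open>a\<close>, a value of \<open>a\<close> above \<open>x\<close> followed by one below \<open>x\<close>
  would form 3142 together with \<open>hd b\<close> and \<open>x\<close>.\<close>

lemma separable_snoc_splits:
  assumes "distinct (a @ b @ [x])" "separable (a @ b @ [x])" "a \<noteq> []" "b \<noteq> []" "below a b"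
  shows "\<exists>p q. a @ b @ [x] = p @ q \<and> p \<noteq> [] \<and> q \<noteq> [] \<and> (below p q \<or> below q p)"
  using assms
proof (induction "length a" arbitrary: a b rule: less_induct)
  case less
  note bel = less.prems(5)[unfolded below_def]
  have "x \<notin> set a \<union> set b" using less.prems(1) by auto
  then have ne: "z < x \<or> x < z" if "z \<in> set a \<union> set b" for z
    using that by (metis linorder_neqE)
  consider "\<forall>y\<in>set a. y < x" | "\<forall>y\<in>set a \<union> set b. x < y"
    | "\<exists>y\<in>set a. x < y" "\<exists>z\<in>set a \<union> set b. z < x"
    using ne by blast
  then show ?case
  proof cases
    case 1
    then have "below a (b @ [x])" using bel by (auto simp: below_def)
    then show ?thesis using less.prems by blast
  next
    case 2
    then have "below [x] (a @ b)" by (auto simp: below_def)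
    moreover have "a @ b @ [x] = (a @ b) @ [x]" by simp
    ultimately show ?thesis using less.prems(3) by (metis append_is_Nil_conv list.distinct(1))
  next
    case 3
    then obtain a1 y a2 where a: "a = a1 @ y # a2" "x < y" "\<forall>z\<in>set a1. \<not> x < z"
      by (metis split_list_first_prop)
    \<comment> \<open>\<open>y\<close> is the first letter of \<open>a\<close> above
      \<open>x\<close>.\<close>
    then have a1: "z < x" if "z \<in> set a1" for z using that ne[of z] by auto
    obtain z where z: "z \<in> set a" "z < x" using 3(2) bel a(1,2)
      by (metis Un_iff in_set_conv_decomp less_asym less_trans)
    show ?thesis
    proof (cases "\<exists>t\<in>set a2. t < x")
      case True
      then obtain a3 t a4 where a2: "a2 = a3 @ t # a4" "t < x" by (metis split_list)
      obtain c b' where b: "b = c # b'" using less.prems(4) by (cases b) auto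
      have "y < c" using bel a b by auto
      have "separable (a1 @ y # a3 @ t # a4 @ c # b' @ x # [])"
        using less.prems(2) a(1) a2(1) b by simp
      from separable_sublistD[OF this] show ?thesis using \<open>y < c\<close> a(2) a2(2) by simp
    next
      case False
      then have a2: "x < t" if "t \<in> set a2" for t using that ne[of t] a by auto
      \<comment> \<open>Now \<open>a\<close> consists of \<open>a1\<close> below \<open>x\<close>
        and \<open>y # a2\<close> above \<open>x\<close>, so \<open>a1\<close> is a shorter bottom
        part and the induction hypothesis applies.\<close>
      have "a1 \<noteq> []" using z a a2 by force
      moreover have "below a1 (y # a2 @ b)" using a1 a2 a(2) bel a(1)
        by (auto simp: below_def dest: less_trans)
      ultimately show ?thesis
        using less.hyps[of a1 "y # a2 @ b"] less.prems(1,2) a(1) by simp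
    qed
  qed
qed

text \<open>Without its last letter the word splits by induction. If the left part is the upper one,
  negating all letters, possible over the integers, leads back to the case where it is the lower
  one.\<close>

lemma separable_splits_int:
  fixes w :: "int list"
  assumes "distinct w" "separable w" "length w \<ge> 2"
  shows "\<exists>p q. w = p @ q \<and> p \<noteq> [] \<and> q \<noteq> [] \<and> (below p q \<or> below q p)"
  using assms
proof (induction w rule: rev_induct)
  case (snoc x u)
  show ?case
  proof (cases "length u \<ge> 2")
    case False
    then obtain y where "u = [y]" using snoc.prems(3) False by (cases u) (auto simp: Suc_le_eq)
    then have "u @ [x] = [y] @ [x] \<and> (below [y] [x] \<or> below [x] [y])"
      using snoc.prems(1) by (auto simp: below_def)
    then show ?thesis by blast
  next
    case True
    then obtain a b where u: "u = a @ b" "a \<noteq> []" "b \<noteq> []" "below a b \<or> below b a"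
      using snoc.IH snoc.prems separable_appendD(1)[of u "[x]"] by auto
    from u(4) show ?thesis
    proof
      assume "below a b"
      then show ?thesis using separable_snoc_splits[of a b x] u snoc.prems by simp
    next
      assume "below b a"
      let ?f = "uminus :: int \<Rightarrow> int"
      have "separable (map ?f (u @ [x]))"
        using snoc.prems(2) by (subst separable_map_strict_antimono) auto
      moreover have "below (map ?f a) (map ?f b)" using \<open>below b a\<close> by (auto simp: below_def)
      moreover have "distinct (map ?f (u @ [x]))" using snoc.prems(1) by (simp only: distinct_map) (simp add: inj_on_def)
      ultimately obtain p q where pq: "map ?f (u @ [x]) = p @ q" "p \<noteq> []" "q \<noteq> []" "below p q \<or> below q p"
        using separable_snoc_splits[of "map ?f a" "map ?f b" "- x"] u by auto
      from arg_cong[OF pq(1), of "map ?f"]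
      have "u @ [x] = map ?f p @ map ?f q" by (simp add: comp_def)
      moreover have "below (map ?f p) (map ?f q) \<or> below (map ?f q) (map ?f p)"
        using pq(4) by (auto simp: below_def)
      ultimately show ?thesis using pq(2,3) by (metis map_is_Nil_conv)
    qed
  qed
qed simp

lemma separable_splits:
  fixes w :: "nat list"
  assumes "distinct w" "separable w" "length w \<ge> 2"
  obtains p q where "w = p @ q" "p \<noteq> []" "q \<noteq> []" "below p q \<or> below q p"
proof -
  have "separable (map int w)" using assms(2) by (subst separable_map_strict_mono) auto
  moreover have "distinct (map int w)" using assms(1) by (simp add: distinct_map)
  ultimately obtain p q where pq: "map int w = p @ q" "p \<noteq> []" "q \<noteq> []" "below p q \<or> below q p"
    using separable_splits_int[of "map int w"] assms(3) by auto
  have "w = map nat (map int w)" by (simp add: comp_def)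
  also have "\<dots> = map nat p @ map nat q" by (simp only: pq map_append)
  finally have w: "w = map nat p @ map nat q" .
  \<comment> \<open>\<open>nat\<close> is strictly monotone only on nonnegative integers.\<close>
  have "set (p @ q) \<subseteq> {0..}" by (simp flip: pq(1)) auto
  then have "below (map nat p) (map nat q) \<or> below (map nat q) (map nat p)"
    using pq(4) by (fastforce simp: below_def)
  then show ?thesis using that[OF w] pq(2,3) by simp
qed

subsection \<open>Decomposition into irreducible words\<close>

text \<open>The offset \<open>a\<close> lets factors keep their actual values, so decompositions are
  literal concatenations and renormalization is postponed to the comparison of
  cardinalities.\<close>

definition dumont_words :: "bool \<Rightarrow> nat \<Rightarrow> nat \<Rightarrow> nat list set" where
  "dumont_words b a m =
     {w. distinct w \<and> set w = {a<..a + m} \<and> dumont_word b w \<and> separable w}"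

definition irreducible_words :: "nat \<Rightarrow> nat list set" where
  "irreducible_words n = {w \<in> dumont_words True 0 (2*n). sum_irreducible w}"

text \<open>The flag is \<open>False\<close> because these words occur as left factors of a skew
  sum, where the last letter is followed by a descent.\<close>

definition skew_irreducible_words :: "nat \<Rightarrow> nat \<Rightarrow> nat list set" where
  "skew_irreducible_words a n = {w \<in> dumont_words False a (2*n). skew_irreducible w}"

definition concat_sets :: "'a list set \<Rightarrow> 'a list set \<Rightarrow> 'a list set" where
  "concat_sets A B = {u @ v |u v. u \<in> A \<and> v \<in> B}"

text \<open>A fixed length of the left factors makes the cut position, hence both factors,
  recoverable.\<close>

lemma card_concat_sets:
  assumes "\<And>u. u \<in> A \<Longrightarrow> length u = m"
  shows "card (concat_sets A B) = card A * card B"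
proof -
  have "concat_sets A B = (\<lambda>(u, v). u @ v) ` (A \<times> B)"
    unfolding concat_sets_def by auto
  moreover have "inj_on (\<lambda>(u, v). u @ v) (A \<times> B)"
    using assms by (auto simp: inj_on_def)
  ultimately show ?thesis by (simp add: card_image card_cartesian_product)
qed

lemma finite_concat_sets: "finite A \<Longrightarrow> finite B \<Longrightarrow> finite (concat_sets A B)"
  unfolding concat_sets_def by (rule finite_image_set2) auto

lemma length_dumont_words: "w \<in> dumont_words b a m \<Longrightarrow> length w = m"
  unfolding dumont_words_def using distinct_card[of w] by auto

lemma finite_dumont_words: "finite (dumont_words b a m)"
  by (rule finite_subset[OF _ finite_subset_distinct[of "{a<..a + m}"]])
     (auto simp: dumont_words_def)

lemma finite_irreducible_words: "finite (irreducible_words n)"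
  unfolding irreducible_words_def using finite_dumont_words by simp

lemma finite_skew_irreducible_words: "finite (skew_irreducible_words a n)"
  unfolding skew_irreducible_words_def using finite_dumont_words by simp

section \<open>Direct sums and skew sums of Dumont words\<close>

text \<open>Everything in the interval below the minimum of \<open>v\<close> must belong to
  \<open>u\<close>, and everything from there on to \<open>v\<close>; counting letters then locates
  the boundary.\<close>

lemma below_intervals:
  fixes u v :: "nat list"
  assumes "distinct (u @ v)" "set (u @ v) = {a<..a + m}" "below u v"
  shows "set u = {a<..a + length u}" "set v = {a + length u<..a + m}" "length u + length v = m"
proof -
  have "card (set (u @ v)) = length u + length v"
    using distinct_card[OF assms(1)] by simp
  then show len: "length u + length v = m" unfolding assms(2) by simp
  have "set u = {a<..a + length u} \<and> set v = {a + length u<..a + m}"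
  proof (cases "v = []")
    case True
    then show ?thesis using assms(2) len by auto
  next
    case False
    define c where "c = Min (set v)"
    have c: "c \<in> set v" "\<And>y. y \<in> set v \<Longrightarrow> c \<le> y"
      unfolding c_def using False by auto
    have uc: "x < c" if "x \<in> set u" for x using assms(3) that c(1) by (auto simp: below_def)
    have iff: "x \<in> set u \<or> x \<in> set v \<longleftrightarrow> a < x \<and> x \<le> a + m" for x
      using assms(2) by (auto simp: set_eq_iff)
    have "x \<in> set u \<longleftrightarrow> x \<in> {a<..<c}" for x
      using iff[of x] iff[of c] uc[of x] c(1) c(2)[of x] by auto
    then have "set u = {a<..<c}" by blast
    moreover have "x \<in> set v \<longleftrightarrow> x \<in> {c..a + m}" for x
      using iff[of x] iff[of c] uc[of x] c(1) c(2)[of x] by auto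
    then have "set v = {c..a + m}" by blast
    moreover have "card (set u) = length u" using assms(1) by (simp add: distinct_card)
    moreover have "a < c" using iff c by blast
    ultimately show ?thesis by auto
  qed
  then show "set u = {a<..a + length u}" "set v = {a + length u<..a + m}" by auto
qed

text \<open>Any sum split would place the first letter below the last.\<close>

lemma sum_irreducibleI:
  assumes "last w \<le> hd w"
  shows "sum_irreducible w"
  unfolding sum_irreducible_def
proof (intro allI impI notI)
  fix u v assume "w = u @ v \<and> u \<noteq> [] \<and> v \<noteq> []" "below u v"
  then have "hd w < last w" by (simp add: below_def)
  with assms show False by simp
qed

lemma dumont_words_append:
  assumes "set u \<union> set v = {a<..a + m}" "distinct u" "distinct v" "u \<noteq> []" "v \<noteq> []"
    and "separable u" "separable v" "dumont_word b v"
    and "below u v \<and> dumont_word True u \<or> below v u \<and> dumont_word False u"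
  shows "u @ v \<in> dumont_words b a m"
proof -
  have "last u \<in> set u" "hd v \<in> set v" using assms(4,5) by auto
  then have "below u v \<Longrightarrow> last u < hd v" "below v u \<Longrightarrow> \<not> last u < hd v"
    by (auto simp: below_def not_less less_imp_le)
  then have "dumont_word (last u < hd v) u"
    using assms(9) by (cases "last u < hd v") auto
  moreover have "set u \<inter> set v = {}" using assms(9) unfolding below_def by auto
  ultimately show ?thesis
    using assms separable_append[of u v] unfolding dumont_words_def
    by (auto simp: dumont_word_append)
qed

lemma dumont_words_appendD:
  assumes "u @ v \<in> dumont_words b a m" "u \<noteq> []" "v \<noteq> []" "below u v"
  shows "u \<in> dumont_words True a (length u)" "v \<in> dumont_words b (a + length u) (length v)"
proof -
  have w: "distinct (u @ v)" "set (u @ v) = {a<..a + m}" "dumont_word b (u @ v)" "separable (u @ v)"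
    using assms(1) by (auto simp: dumont_words_def)
  note sets = below_intervals[OF w(1,2) assms(4)]
  have "last u < hd v" using assms(2-4) by (simp add: below_def)
  then have d: "dumont_word True u" "dumont_word b v"
    using w(3) assms(2,3) by (auto simp: dumont_word_append)
  show "u \<in> dumont_words True a (length u)"
    using w(1) sets(1) d separable_appendD(1)[OF w(4)] by (simp add: dumont_words_def)
  show "v \<in> dumont_words b (a + length u) (length v)"
    using w(1) sets(2) sets(3)[symmetric] d separable_appendD(2)[OF w(4)]
    by (simp add: dumont_words_def add.assoc)
qed

lemma dumont_words_skew_appendD:
  assumes "u @ v \<in> dumont_words b a m" "u \<noteq> []" "v \<noteq> []" "below v u"
  shows "u \<in> dumont_words False (a + length v) (length u)" "v \<in> dumont_words b a (length v)"
proof -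
  have w: "distinct (u @ v)" "set (u @ v) = {a<..a + m}" "dumont_word b (u @ v)" "separable (u @ v)"
    using assms(1) by (auto simp: dumont_words_def)
  have "distinct (v @ u)" "set (v @ u) = {a<..a + m}" using w by auto
  note sets = below_intervals[OF this assms(4)]
  have "\<not> last u < hd v" using assms(2-4) by (simp add: below_def less_imp_le not_less)
  then have d: "dumont_word False u" "dumont_word b v"
    using w(3) assms(2,3) by (auto simp: dumont_word_append)
  show "u \<in> dumont_words False (a + length v) (length u)"
    using w(1) sets(2) sets(3)[symmetric] d separable_appendD(1)[OF w(4)]
    by (simp add: dumont_words_def add.assoc)
  show "v \<in> dumont_words b a (length v)"
    using w(1) sets(1) d separable_appendD(2)[OF w(4)]
    by (simp add: dumont_words_def)
qed

text \<open>Take the shortest nonempty prefix lying below the rest: a sum split of it would give a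
  shorter one. The whole word qualifies, with empty rest.\<close>

lemma first_sum_irreducible_factor:
  assumes "w \<noteq> []"
  obtains u v where "w = u @ v" "u \<noteq> []" "below u v" "sum_irreducible u"
proof -
  let ?P = "\<lambda>k. \<exists>u v. w = u @ v \<and> u \<noteq> [] \<and> below u v \<and> length u = k"
  have "?P (length w)" using assms by (intro exI[of _ w] exI[of _ "[]"]) (simp add: below_def)
  then have "?P (Least ?P)" by (rule LeastI)
  then obtain u v where uv: "w = u @ v" "u \<noteq> []" "below u v" "length u = Least ?P" by blast
  have "sum_irreducible u"
    unfolding sum_irreducible_def
  proof (intro allI impI notI)
    fix u1 u2 assume u: "u = u1 @ u2 \<and> u1 \<noteq> [] \<and> u2 \<noteq> []" "below u1 u2"
    then have "?P (length u1)"
      using uv by (intro exI[of _ u1] exI[of _ "u2 @ v"]) simp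
    then have "length u \<le> length u1" unfolding uv(4) by (rule Least_le)
    then show False using u by simp
  qed
  with uv that show ?thesis by blast
qed

text \<open>Again a shortest prefix, but the rest must stay nonempty, so existence comes from the
  given split of \<open>w\<close>.\<close>

lemma first_skew_irreducible_factor:
  assumes "w = p @ q" "p \<noteq> []" "q \<noteq> []" "below q p"
  obtains u v where "w = u @ v" "u \<noteq> []" "v \<noteq> []" "below v u" "skew_irreducible u"
proof -
  let ?P = "\<lambda>k. \<exists>u v. w = u @ v \<and> u \<noteq> [] \<and> v \<noteq> [] \<and> below v u \<and> length u = k"
  have "?P (length p)" using assms by blast
  then have "?P (Least ?P)" by (rule LeastI)
  then obtain u v where uv: "w = u @ v" "u \<noteq> []" "v \<noteq> []" "below v u" "length u = Least ?P" by blast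
  have "skew_irreducible u"
    unfolding skew_irreducible_def
  proof (intro allI impI notI)
    fix u1 u2 assume u: "u = u1 @ u2 \<and> u1 \<noteq> [] \<and> u2 \<noteq> []" "below u2 u1"
    then have "?P (length u1)"
      using uv by (intro exI[of _ u1] exI[of _ "u2 @ v"]) simp
    then have "length u \<le> length u1" unfolding uv(5) by (rule Least_le)
    then show False using u by simp
  qed
  with uv that show ?thesis by blast
qed

lemma dumont_words_decomposition:
  assumes "n \<ge> 1"
  shows "dumont_words True 0 (2*n) =
    (\<Union>k\<in>{1..n}. concat_sets (irreducible_words k) (dumont_words True (2*k) (2*(n-k))))"
    (is "?L = ?R")
proof
  show "?L \<subseteq> ?R"
  proof
    fix w assume w: "w \<in> ?L"
    then have "w \<noteq> []" using assms length_dumont_words by fastforce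
    then obtain u v where uv: "w = u @ v" "u \<noteq> []" "below u v" "sum_irreducible u"
      by (rule first_sum_irreducible_factor)
    have len: "length u + length v = 2*n" using length_dumont_words[OF w] uv(1) by simp
    have "even (length u) \<and> u \<in> dumont_words True 0 (length u) \<and>
          v \<in> dumont_words True (length u) (length v)"
    proof (cases "v = []")
      case True
      then show ?thesis using w uv len by (simp add: dumont_words_def separable_def)
    next
      case False
      from dumont_words_appendD[OF w[unfolded uv(1)] uv(2) False uv(3)]
      have u: "u \<in> dumont_words True 0 (length u)" and v: "v \<in> dumont_words True (length u) (length v)"
        by auto
      \<comment> \<open>\<open>length u + 1\<close> is the least letter of \<open>v\<close>, and the
        least letter of a Dumont word is odd.\<close>
      have "odd (length u + 1)"
        using v False by (intro dumont_word_min_odd[of v]) (auto simp: dumont_words_def Suc_le_eq)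
      with u v show ?thesis by simp
    qed
    then obtain k where k: "length u = 2*k" "u \<in> irreducible_words k"
        "v \<in> dumont_words True (2*k) (length v)"
      using uv(4) unfolding irreducible_words_def by (auto elim!: evenE)
    moreover have "0 < length u" using uv(2) by simp
    then have "1 \<le> k" "k \<le> n" "length v = 2*(n-k)" using len k(1) by linarith+
    ultimately have "w \<in> concat_sets (irreducible_words k) (dumont_words True (2*k) (2*(n-k)))"
      unfolding concat_sets_def uv(1) by auto
    then show "w \<in> ?R" using \<open>1 \<le> k\<close> \<open>k \<le> n\<close> by (intro UN_I[of k]) auto
  qed
  show "?R \<subseteq> ?L"
  proof
    fix w assume "w \<in> ?R"
    then obtain k u v where k: "1 \<le> k" "k \<le> n" and w: "w = u @ v"
      and u: "u \<in> irreducible_words k" and v: "v \<in> dumont_words True (2*k) (2*(n-k))"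
      unfolding concat_sets_def by auto
    have lu: "length u = 2*k" and lv: "length v = 2*(n-k)"
      using u v length_dumont_words by (auto simp: irreducible_words_def)
    show "w \<in> ?L"
    proof (cases "v = []")
      case True
      then show ?thesis using w u lv k by (simp add: irreducible_words_def)
    next
      case False
      have "set u = {0<..2*k}" "set v = {2*k<..2*n}"
        using u v k by (auto simp: irreducible_words_def dumont_words_def)
      then have "set u \<union> set v = {0<..0 + 2*n}" "below u v" using k by (auto simp: below_def)
      then show ?thesis unfolding w using u v lu k False
        by (intro dumont_words_append) (auto simp: irreducible_words_def dumont_words_def)
    qed
  qed
qed

section \<open>Uniqueness and shape of the decompositions\<close>

text \<open>Makes the union over \<open>k\<close> disjoint. Otherwise \<open>u'\<close> would extend
  \<open>u\<close> by a prefix of \<open>v\<close>, whose letters all exceed those of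
  \<open>u\<close>, and so would split as a sum.\<close>

lemma irreducible_words_prefix_free:
  assumes "u \<in> irreducible_words k" "u' \<in> irreducible_words k'" "1 \<le> k" "k < k'"
    and "v \<in> dumont_words True (2*k) m"
  shows "u @ v \<noteq> u' @ v'"
proof
  assume eq: "u @ v = u' @ v'"
  have lu: "length u = 2*k" "length u' = 2*k'"
    using assms(1,2) length_dumont_words by (auto simp: irreducible_words_def)
  have z: "u' = u @ drop (2*k) u'" "v = drop (2*k) u' @ v'"
    using eq lu assms(4) by (auto simp: append_eq_append_conv_if)
  have "set (drop (2*k) u') \<subseteq> {2*k<..}"
  proof -
    have "set (drop (2*k) u') \<subseteq> set v" by (subst z(2)) auto
    also have "\<dots> \<subseteq> {2*k<..}" using assms(5) by (auto simp: dumont_words_def)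
    finally show ?thesis .
  qed
  then have "below u (drop (2*k) u')"
    using assms(1) by (fastforce simp: irreducible_words_def dumont_words_def below_def)
  moreover have "u \<noteq> []" "drop (2*k) u' \<noteq> []" using lu assms(3,4) by auto
  ultimately show False
    using z(1) assms(2) unfolding irreducible_words_def sum_irreducible_def by blast
qed

lemma skew_irreducible_words_prefix_free:
  assumes "u \<in> skew_irreducible_words (2*(n-k)) k" "u' \<in> skew_irreducible_words (2*(n-k')) k'"
    and "1 \<le> k" "k < k'" "v \<in> dumont_words True 0 (2*(n-k))"
  shows "u @ v \<noteq> u' @ v'"
proof
  assume eq: "u @ v = u' @ v'"
  have lu: "length u = 2*k" "length u' = 2*k'"
    using assms(1,2) length_dumont_words by (auto simp: skew_irreducible_words_def)
  have z: "u' = u @ drop (2*k) u'" "v = drop (2*k) u' @ v'"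
    using eq lu assms(4) by (auto simp: append_eq_append_conv_if)
  have "set (drop (2*k) u') \<subseteq> set v" by (subst z(2)) auto
  then have "below (drop (2*k) u') u"
    using assms(1,5) by (fastforce simp: skew_irreducible_words_def dumont_words_def below_def)
  moreover have "u \<noteq> []" "drop (2*k) u' \<noteq> []" using lu assms(3,4) by auto
  ultimately show False
    using z(1) assms(2) unfolding skew_irreducible_words_def skew_irreducible_def by blast
qed

text \<open>The word is the skew sum of \<open>2*n\<close> with the direct sum of \<open>v\<close>
  and \<open>2*n-1\<close>. It starts with its maximum, which rules out a sum split.\<close>

lemma cons_snoc_in_irreducible_words:
  assumes "n \<ge> 1" "v \<in> dumont_words True 0 (2*(n-1))"
  shows "2*n # v @ [2*n-1] \<in> irreducible_words n"
proof -
  have sv: "set v = {0<..2*(n-1)}" "distinct v" "dumont_word True v" "separable v"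
    using assms(2) by (auto simp: dumont_words_def)
  have single: "separable [x]" for x :: nat by (simp add: separable_def)
  have "v @ [2*n-1] \<in> dumont_words True 0 (2*n-1)"
  proof (cases "v = []")
    case True
    then have "n = 1" using length_dumont_words[OF assms(2)] assms(1) by simp
    with True show ?thesis by (auto simp: dumont_words_def single)
  next
    case False
    then show ?thesis using sv assms(1) single
      by (intro dumont_words_append) (auto simp: below_def)
  qed
  then have "[2*n] @ (v @ [2*n-1]) \<in> dumont_words True 0 (2*n)"
    using assms(1) single
    by (intro dumont_words_append) (auto simp: below_def dumont_words_def)
  moreover have "sum_irreducible (2*n # v @ [2*n-1])"
    by (rule sum_irreducibleI) simp
  ultimately show ?thesis by (simp add: irreducible_words_def)
qed

lemma append_in_irreducible_words:
  assumes "1 \<le> k" "k < n" "u \<in> skew_irreducible_words (2*(n-k)) k" "v \<in> dumont_words True 0 (2*(n-k))"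
  shows "u @ v \<in> irreducible_words n"
proof -
  have lu: "length u = 2*k" and lv: "length v = 2*(n-k)"
    using assms length_dumont_words by (auto simp: skew_irreducible_words_def)
  have ne: "u \<noteq> []" "v \<noteq> []" using lu lv assms(1,2) by auto
  have "2*(n-k) + 2*k = 2*n" using assms(2) by simp
  then have s: "set u = {2*(n-k)<..2*n}" "set v = {0<..2*(n-k)}"
    using assms(3,4) by (auto simp: skew_irreducible_words_def dumont_words_def)
  then have b: "below v u" by (auto simp: below_def)
  have "set u \<union> set v = {0<..0 + 2*n}" using s assms(2) by auto
  then have "u @ v \<in> dumont_words True 0 (2*n)" using b ne assms(3,4)
    by (intro dumont_words_append) (auto simp: skew_irreducible_words_def dumont_words_def)
  moreover have "last (u @ v) < hd (u @ v)" using b ne by (simp add: below_def)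
  then have "sum_irreducible (u @ v)" by (intro sum_irreducibleI) simp
  ultimately show ?thesis by (simp add: irreducible_words_def)
qed

text \<open>The first skew component has even length unless it is the single letter \<open>2*n\<close>: its least
  value is otherwise even, hence must be its last letter, and would split off.\<close>

lemma irreducible_words_decomposition:
  assumes "n \<ge> 1"
  shows "irreducible_words n =
    (\<Union>k\<in>{1..<n}. concat_sets (skew_irreducible_words (2*(n-k)) k) (dumont_words True 0 (2*(n-k)))) \<union>
    (\<lambda>v. 2*n # v @ [2*n-1]) ` dumont_words True 0 (2*(n-1))"
    (is "?L = ?A \<union> ?B")
proof
  show "?A \<union> ?B \<subseteq> ?L"
  proof (rule Un_least)
    show "?A \<subseteq> ?L"
    proof (intro UN_least subsetI)
      fix k w
      assume k: "k \<in> {1..<n}"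
        and "w \<in> concat_sets (skew_irreducible_words (2*(n-k)) k) (dumont_words True 0 (2*(n-k)))"
      then obtain u v where "w = u @ v"
          "u \<in> skew_irreducible_words (2*(n-k)) k" "v \<in> dumont_words True 0 (2*(n-k))"
        unfolding concat_sets_def by blast
      then show "w \<in> ?L" using k append_in_irreducible_words[of k n u v] by simp
    qed
    show "?B \<subseteq> ?L" using cons_snoc_in_irreducible_words[OF assms] by (rule image_subsetI)
  qed
  show "?L \<subseteq> ?A \<union> ?B"
  proof
    fix w assume "w \<in> ?L"
    then have w: "w \<in> dumont_words True 0 (2*n)" "sum_irreducible w"
      by (auto simp: irreducible_words_def)
    then have lw: "length w = 2*n" "distinct w" "separable w"
      using length_dumont_words[OF w(1)] by (auto simp: dumont_words_def)
    have "length w \<ge> 2" using lw assms by simp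
    then obtain p q where pq: "w = p @ q" "p \<noteq> []" "q \<noteq> []" "below p q \<or> below q p"
      by (rule separable_splits[OF lw(2,3)])
    then have "below q p"
      using w(2)[unfolded sum_irreducible_def, rule_format, of p q] by simp
    then obtain u v where uv: "w = u @ v" "u \<noteq> []" "v \<noteq> []" "below v u" "skew_irreducible u"
      by (rule first_skew_irreducible_factor[OF pq(1-3)])
    have len: "length u + length v = 2*n" using lw(1) uv(1) by simp
    note D = dumont_words_skew_appendD[OF w(1)[unfolded uv(1)] uv(2-4)]
    show "w \<in> ?A \<union> ?B"
    proof (cases "even (length u)")
      case True
      then obtain k where k: "length u = 2*k" by (auto elim: evenE)
      moreover have "0 < length u" "0 < length v" using uv(2,3) by simp_all
      ultimately have "1 \<le> k" "k < n" "length v = 2*(n-k)" using len by linarith+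
      then have k': "length v = 2*(n-k)" "k \<in> {1..<n}" by simp_all
      have "u \<in> skew_irreducible_words (2*(n-k)) k"
        using D(1) uv(5) k k'(1) by (simp add: skew_irreducible_words_def)
      moreover have "v \<in> dumont_words True 0 (2*(n-k))" using D(2) k'(1) by simp
      ultimately have "w \<in> concat_sets (skew_irreducible_words (2*(n-k)) k) (dumont_words True 0 (2*(n-k)))"
        unfolding concat_sets_def uv(1) by blast
      then show ?thesis using k'(2) by (intro UnI1 UN_I)
    next
      case False
      then have oddv: "odd (length v)" using len by presburger
      have "0 < length u" using uv(2) by simp
      then have "length v < 2*n" using len by linarith
      have su: "set u = {length v<..2*n}" "distinct u" "dumont_word False u"
        using D(1) len by (auto simp: dumont_words_def add.commute)
      have sv: "set v = {0<..length v}" "distinct v" "dumont_word True v" "separable v"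
        using D(2) by (auto simp: dumont_words_def)
      have "last u = length v + 1"
        using su uv(2) oddv len \<open>length v < 2*n\<close>
        by (intro dumont_word_min_even_last[OF su(3,2)]) (auto simp: Suc_le_eq)
      then obtain u0 where u0: "u = u0 @ [length v + 1]"
        using append_butlast_last_id[OF uv(2)] by metis
      have "length v + 1 < x" if x: "x \<in> set u0" for x
      proof -
        have "x \<in> {length v<..2*n}" using x u0 su(1) by auto
        moreover have "x \<noteq> length v + 1" using x su(2) unfolding u0 by auto
        ultimately show ?thesis by auto
      qed
      then have "below [length v + 1] u0" by (simp add: below_def)
      then have "u0 = []"
        using uv(5)[unfolded skew_irreducible_def, rule_format, of u0 "[length v + 1]"] u0 by auto
      with u0 have u: "u = [length v + 1]" by simp
      then have lv: "length v = 2*n-1" using len by simp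
      \<comment> \<open>\<open>length v\<close> is the largest letter of \<open>v\<close>; being odd
        it would need a larger successor unless it is last.\<close>
      have "last v = length v"
        using sv uv(3) oddv by (intro dumont_word_max_odd_last[OF sv(3,2)]) auto
      then obtain v0 where v: "v = v0 @ [2*n-1]"
        using append_butlast_last_id[OF uv(3)] lv by metis
      have "v0 \<in> dumont_words True 0 (2*(n-1))"
      proof (cases "v0 = []")
        case True
        then have "n = 1" using lv assms unfolding v by simp
        with True show ?thesis by (simp add: dumont_words_def separable_def)
      next
        case False
        have dv: "distinct v0" "2*n-1 \<notin> set v0" using sv(2) unfolding v by auto
        have iff: "x \<in> set v0 \<or> x = 2*n-1 \<longleftrightarrow> 0 < x \<and> x \<le> 2*n-1" for x
          using sv(1) lv unfolding v by (auto simp: set_eq_iff)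
        have "x \<in> set v0 \<longleftrightarrow> 0 < x \<and> x \<le> 2*(n-1)" for x
        proof (cases "x = 2*n-1")
          case True
          then show ?thesis using dv(2) assms by auto
        next
          case False
          then have "x \<le> 2*(n-1) \<longleftrightarrow> x \<le> 2*n-1" using assms by auto
          then show ?thesis using iff[of x] False by blast
        qed
        then have set_v0: "set v0 = {0<..2*(n-1)}"
          unfolding set_eq_iff greaterThanAtMost_iff by (rule allI)
        then have "last v0 < 2*n-1"
          using last_in_set[OF False] assms by auto
        \<comment> \<open>The letter after \<open>v0\<close> is the larger \<open>2*n-1\<close>, so
          the cut leaves the flag \<open>True\<close>.\<close>
        then have "dumont_word True v0"
          using sv(3) dumont_word_append[OF False, of "[2*n-1]" True] unfolding v by simp
        moreover have "separable v0" using sv(4) unfolding v by (rule separable_appendD(1))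
        ultimately show ?thesis using dv set_v0 by (simp add: dumont_words_def)
      qed
      moreover have "length v + 1 = 2*n" using lv assms by simp
      then have "w = 2*n # v0 @ [2*n-1]" unfolding uv(1) u by (simp add: v)
      ultimately show ?thesis by (intro UnI2 rev_image_eqI)
    qed
  qed
qed

section \<open>Cardinalities: shift, complement and the two recurrences\<close>

lemma card_dumont_words_shift:
  "card (dumont_words b (2*k) m) = card (dumont_words b 0 m)"
proof -
  let ?f = "map (\<lambda>x. x + 2*k)" and ?g = "map (\<lambda>x. x - 2*k)"
  have img: "(\<lambda>x. x + 2*k) ` {0<..m} = {2*k<..2*k + m}"
    using image_add_greaterThanAtMost[of "2*k" 0 m] by (simp add: add.commute)
  have inv: "?f (?g w) = w" if "set w \<subseteq> {2*k<..}" for w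
    using that by (induction w) auto
  have f: "?f w \<in> dumont_words b (2*k) m \<longleftrightarrow> w \<in> dumont_words b 0 m" if "set w \<subseteq> {0<..}" for w
  proof -
    have "set (?f w) = {2*k<..2*k + m} \<longleftrightarrow> set w = {0<..m}"
      unfolding set_map img[symmetric] by (rule inj_image_eq_iff) (simp add: inj_def)
    moreover have "separable (?f w) = separable w" by (rule separable_map_strict_mono) simp
    moreover have "distinct (?f w) = distinct w" by (simp add: distinct_map inj_on_def)
    ultimately show ?thesis
      unfolding dumont_words_def by (simp add: dumont_word_map_shift)
  qed
  have s1: "set w \<subseteq> {0<..}" if "w \<in> dumont_words b 0 m" for w
    using that by (auto simp: dumont_words_def)
  have s2: "set w \<subseteq> {2*k<..}" if "w \<in> dumont_words b (2*k) m" for w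
    using that by (auto simp: dumont_words_def)
  have "bij_betw ?f (dumont_words b 0 m) (dumont_words b (2*k) m)"
  proof (rule bij_betw_byWitness[where f' = ?g])
    show "\<forall>w\<in>dumont_words b 0 m. ?g (?f w) = w" by (simp add: comp_def)
    show *: "\<forall>w\<in>dumont_words b (2*k) m. ?f (?g w) = w"
      by (intro ballI inv s2)
    show "?f ` dumont_words b 0 m \<subseteq> dumont_words b (2*k) m"
      using f s1 by blast
    show "?g ` dumont_words b (2*k) m \<subseteq> dumont_words b 0 m"
    proof clarify
      fix w assume w: "w \<in> dumont_words b (2*k) m"
      then have "set (?g w) \<subseteq> {0<..}" using s2[OF w] by auto
      from f[OF this] show "?g w \<in> dumont_words b 0 m" using * w by simp
    qed
  qed
  then show ?thesis by (simp add: bij_betw_same_card)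
qed

lemma skew_irreducible_map_strict_antimono:
  assumes "\<And>x y. x \<in> set w \<Longrightarrow> y \<in> set w \<Longrightarrow> f x < f y \<longleftrightarrow> y < x"
  shows "skew_irreducible (map f w) \<longleftrightarrow> sum_irreducible w"
proof -
  have *: "below (map f v) (map f u) \<longleftrightarrow> below u v" if "w = u @ v" for u v
    using assms that by (auto simp: below_def)
  show ?thesis
  proof
    assume skew: "skew_irreducible (map f w)"
    show "sum_irreducible w"
      unfolding sum_irreducible_def
    proof (intro allI impI)
      fix u v assume w: "w = u @ v \<and> u \<noteq> [] \<and> v \<noteq> []"
      then have "\<not> below (map f v) (map f u)"
        using skew[unfolded skew_irreducible_def, rule_format, of "map f u" "map f v"] by simp
      then show "\<not> below u v" using * w by blast
    qed
  next
    assume sum: "sum_irreducible w"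
    show "skew_irreducible (map f w)"
      unfolding skew_irreducible_def
    proof (intro allI impI)
      fix u v assume "map f w = u @ v \<and> u \<noteq> [] \<and> v \<noteq> []"
      then obtain u' v' where w: "w = u' @ v'" "u = map f u'" "v = map f v'" "u' \<noteq> []" "v' \<noteq> []"
        by (auto simp: map_eq_append_conv)
      then have "\<not> below u' v'" using sum unfolding sum_irreducible_def by blast
      then show "\<not> below v u" using *[OF w(1)] w(2,3) by simp
    qed
  qed
qed

lemma card_skew_irreducible_words:
  "card (skew_irreducible_words (2*a) k) = card (irreducible_words k)"
proof -
  \<comment> \<open>The sum of the extreme values: \<open>c - x\<close> maps 1 to
    \<open>2*a + 2*k\<close> and \<open>2*k\<close> to \<open>2*a + 1\<close>. It is odd, as the
    complement lemma for Dumont words demands.\<close>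
  define c where "c = 2*a + 2*k + 1"
  let ?f = "map (\<lambda>x. c - x)"
  have anti: "c - x < c - y \<longleftrightarrow> y < x" if "x \<le> c" "y \<le> c" for x y using that by auto
  have inv: "?f (?f w) = w" if "set w \<subseteq> {..c}" for w
    using that by (induction w) auto
  have f: "?f w \<in> skew_irreducible_words (2*a) k \<longleftrightarrow> w \<in> irreducible_words k" if "set w \<subseteq> {..c}" for w
  proof -
    have inj: "inj_on (\<lambda>x. c - x) {..c}" by (auto simp: inj_on_def)
    have "x \<in> (\<lambda>x. c - x) ` {0<..2*k} \<longleftrightarrow> x \<in> {2*a<..2*a + 2*k}" for x
      unfolding image_iff c_def
      by (auto intro!: bexI[of _ "2*a + 2*k + 1 - x"])
    then have img: "(\<lambda>x. c - x) ` {0<..2*k} = {2*a<..2*a + 2*k}" by blast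
    have "set (?f w) = {2*a<..2*a + 2*k} \<longleftrightarrow> set w = {0<..2*k}"
      unfolding set_map img[symmetric] using inj that
      by (rule inj_on_image_eq_iff) (auto simp: c_def)
    moreover have "separable (?f w) = separable w"
      using that anti by (intro separable_map_strict_antimono) auto
    moreover have "skew_irreducible (?f w) = sum_irreducible w"
      using that anti by (intro skew_irreducible_map_strict_antimono) auto
    moreover have "distinct (?f w) = distinct w"
      using inj that by (auto simp: distinct_map intro: inj_on_subset)
    moreover have "dumont_word False (?f w) = dumont_word True w" if "distinct w"
      using that \<open>set w \<subseteq> {..c}\<close> by (subst dumont_word_map_complement) (auto simp: c_def)
    ultimately show ?thesis
      unfolding dumont_words_def skew_irreducible_words_def irreducible_words_def by auto
  qed
  have s1: "set w \<subseteq> {..c}" if "w \<in> irreducible_words k" for w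
    using that by (auto simp: irreducible_words_def dumont_words_def c_def)
  have s2: "set w \<subseteq> {..c}" if "w \<in> skew_irreducible_words (2*a) k" for w
    using that by (auto simp: skew_irreducible_words_def dumont_words_def c_def)
  have "bij_betw ?f (irreducible_words k) (skew_irreducible_words (2*a) k)"
  proof (rule bij_betw_byWitness[where f' = ?f])
    show "\<forall>w\<in>irreducible_words k. ?f (?f w) = w" using inv s1 by blast
    show *: "\<forall>w\<in>skew_irreducible_words (2*a) k. ?f (?f w) = w" using inv s2 by blast
    show "?f ` irreducible_words k \<subseteq> skew_irreducible_words (2*a) k"
      using f s1 by blast
    show "?f ` skew_irreducible_words (2*a) k \<subseteq> irreducible_words k"
    proof clarify
      fix w assume w: "w \<in> skew_irreducible_words (2*a) k"
      have "set (?f w) \<subseteq> {..c}" by auto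
      from f[OF this] show "?f w \<in> irreducible_words k" using * w by simp
    qed
  qed
  then show ?thesis by (simp add: bij_betw_same_card)
qed

lemma card_dumont_words_rec:
  assumes "n \<ge> 1"
  shows "card (dumont_words True 0 (2*n)) =
    (\<Sum>k=1..n. card (irreducible_words k) * card (dumont_words True 0 (2*(n-k))))"
proof -
  let ?C = "\<lambda>k. concat_sets (irreducible_words k) (dumont_words True (2*k) (2*(n-k)))"
  have ne: "?C k \<inter> ?C k' = {}" if "1 \<le> k" "k < k'" for k k'
  proof (rule equals0I)
    fix w assume "w \<in> ?C k \<inter> ?C k'"
    then have "w \<in> ?C k" "w \<in> ?C k'" by simp_all
    from this(1) obtain u v where uv: "w = u @ v" "u \<in> irreducible_words k" "v \<in> dumont_words True (2*k) (2*(n-k))"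
      unfolding concat_sets_def by blast
    from \<open>w \<in> ?C k'\<close> obtain u' v' where "w = u' @ v'" "u' \<in> irreducible_words k'"
      unfolding concat_sets_def by blast
    then show False using uv irreducible_words_prefix_free[OF _ _ that, of u u' v] by metis
  qed
  have "?C k \<inter> ?C k' = {}" if "k \<in> {1..n}" "k' \<in> {1..n}" "k \<noteq> k'" for k k'
    using that ne[of k k'] ne[of k' k] by (auto simp: neq_iff)
  then have "card (\<Union>k\<in>{1..n}. ?C k) = (\<Sum>k=1..n. card (?C k))"
    by (intro card_UN_disjoint) (auto intro!: finite_concat_sets finite_irreducible_words finite_dumont_words)
  also have "\<dots> = (\<Sum>k=1..n. card (irreducible_words k) * card (dumont_words True 0 (2*(n-k))))"
  proof (rule sum.cong[OF refl])
    fix k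
    have "card (?C k) = card (irreducible_words k) * card (dumont_words True (2*k) (2*(n-k)))"
      by (rule card_concat_sets[of _ "2*k"]) (auto simp: irreducible_words_def dest: length_dumont_words)
    then show "card (?C k) = card (irreducible_words k) * card (dumont_words True 0 (2*(n-k)))"
      by (simp only: card_dumont_words_shift)
  qed
  finally show ?thesis using dumont_words_decomposition[OF assms] by simp
qed

lemma card_irreducible_words_rec:
  assumes "n \<ge> 1"
  shows "card (irreducible_words n) = card (dumont_words True 0 (2*(n-1))) +
    (\<Sum>k=1..<n. card (irreducible_words k) * card (dumont_words True 0 (2*(n-k))))"
proof -
  let ?C = "\<lambda>k. concat_sets (skew_irreducible_words (2*(n-k)) k) (dumont_words True 0 (2*(n-k)))"
  let ?B = "(\<lambda>v. 2*n # v @ [2*n-1]) ` dumont_words True 0 (2*(n-1))"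
  have ne: "?C k \<inter> ?C k' = {}" if "1 \<le> k" "k < k'" for k k'
  proof (rule equals0I)
    fix w assume "w \<in> ?C k \<inter> ?C k'"
    then have "w \<in> ?C k" "w \<in> ?C k'" by simp_all
    from this(1) obtain u v where uv: "w = u @ v" "u \<in> skew_irreducible_words (2*(n-k)) k" "v \<in> dumont_words True 0 (2*(n-k))"
      unfolding concat_sets_def by blast
    from \<open>w \<in> ?C k'\<close> obtain u' v' where "w = u' @ v'" "u' \<in> skew_irreducible_words (2*(n-k')) k'"
      unfolding concat_sets_def by blast
    then show False using uv skew_irreducible_words_prefix_free[OF _ _ that, of u _ u' v] by metis
  qed
  have "?C k \<inter> ?C k' = {}" if "k \<in> {1..<n}" "k' \<in> {1..<n}" "k \<noteq> k'" for k k'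
    using that ne[of k k'] ne[of k' k] by (auto simp: neq_iff)
  then have "card (\<Union>k\<in>{1..<n}. ?C k) = (\<Sum>k=1..<n. card (?C k))"
    by (intro card_UN_disjoint)
       (auto intro!: finite_concat_sets finite_skew_irreducible_words finite_dumont_words)
  also have "\<dots> = (\<Sum>k=1..<n. card (irreducible_words k) * card (dumont_words True 0 (2*(n-k))))"
  proof (rule sum.cong[OF refl])
    fix k
    have "card (?C k) = card (skew_irreducible_words (2*(n-k)) k) * card (dumont_words True 0 (2*(n-k)))"
      by (rule card_concat_sets[of _ "2*k"]) (auto simp: skew_irreducible_words_def dest: length_dumont_words)
    then show "card (?C k) = card (irreducible_words k) * card (dumont_words True 0 (2*(n-k)))"
      by (simp only: card_skew_irreducible_words)
  qed
  finally have A: "card (\<Union>k\<in>{1..<n}. ?C k) =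
    (\<Sum>k=1..<n. card (irreducible_words k) * card (dumont_words True 0 (2*(n-k))))" .
  have B: "card ?B = card (dumont_words True 0 (2*(n-1)))"
    by (rule card_image) (simp add: inj_on_def)
  have "?C k \<inter> ?B = {}" if k: "k \<in> {1..<n}" for k
  proof -
    \<comment> \<open>\<open>2*n\<close> is the maximum of \<open>u\<close>; as first letter of a
      longer word it would split off as a skew component.\<close>
    have "u @ v \<noteq> 2*n # v'" if u: "u \<in> skew_irreducible_words (2*(n-k)) k" for u v v'
    proof
      assume eq: "u @ v = 2*n # v'"
      have lu: "length u = 2*k" using u length_dumont_words by (auto simp: skew_irreducible_words_def)
      then obtain u' where u': "u = [2*n] @ u'" using eq k by (cases u) auto
      have "k < n" using k by simp
      then have "2*(n-k) + 2*k = 2*n" by simp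
      then have "set u = {2*(n-k)<..2*n}" "distinct u"
        using u by (auto simp: skew_irreducible_words_def dumont_words_def)
      then have "x \<le> 2*n \<and> x \<noteq> 2*n" if "x \<in> set u'" for x
        using that u' by (metis Un_iff append_Cons distinct.simps(2) greaterThanAtMost_iff self_append_conv2 set_append)
      then have "below u' [2*n]" by (simp add: below_def le_neq_implies_less)
      moreover have "u' \<noteq> []" using u' lu k by auto
      moreover have "skew_irreducible u" using u by (simp add: skew_irreducible_words_def)
      ultimately show False
        using u' unfolding skew_irreducible_def by (metis not_Cons_self2)
    qed
    note no_overlap = this
    show ?thesis
    proof (rule equals0I)
      fix w assume "w \<in> ?C k \<inter> ?B"
      then have "w \<in> ?C k" "w \<in> ?B" by simp_all
      from this(1) obtain u v where u: "w = u @ v" "u \<in> skew_irreducible_words (2*(n-k)) k"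
        unfolding concat_sets_def by blast
      from \<open>w \<in> ?B\<close> obtain x where "w = 2*n # x @ [2*n-1]" by blast
      with u show False using no_overlap[of u v "x @ [2*n-1]"] by simp
    qed
  qed
  then have "(\<Union>k\<in>{1..<n}. ?C k) \<inter> ?B = {}" by blast
  moreover have "finite (\<Union>k\<in>{1..<n}. ?C k)"
    by (auto intro!: finite_concat_sets finite_skew_irreducible_words finite_dumont_words)
  moreover have "finite ?B" using finite_dumont_words by blast
  ultimately have "card ((\<Union>k\<in>{1..<n}. ?C k) \<union> ?B) = card (\<Union>k\<in>{1..<n}. ?C k) + card ?B"
    by (intro card_Un_disjoint)
  then show ?thesis unfolding A B irreducible_words_decomposition[OF assms] by simp
qed

subsection \<open>From permutations to words\<close>

lemma dumont_word_nth:
  "dumont_word b w \<longleftrightarrow>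
     (\<forall>i<length w - 1. odd (w ! i) = (w ! i < w ! Suc i)) \<and> (w \<noteq> [] \<longrightarrow> odd (last w) = b)"
proof (induction w rule: induct_list012)
  case (3 x y zs)
  have "(\<forall>i<length (x # y # zs) - 1. P i) \<longleftrightarrow> P 0 \<and> (\<forall>i<length (y # zs) - 1. P (Suc i))" for P
    by (simp add: All_less_Suc2)
  then show ?case using 3(2) by simp
qed auto

lemma all_less_4: "(\<forall>i<(4::nat). P i) \<longleftrightarrow> P 0 \<and> P 1 \<and> P 2 \<and> P 3"
  by (simp add: numeral_eq_Suc All_less_Suc conj_ac)

lemma contains_pattern_4:
  "contains_pattern \<sigma> m [a, b, c, d] \<longleftrightarrow>
    (\<exists>i j k l. 1 \<le> i \<and> i < j \<and> j < k \<and> k < l \<and> l \<le> m \<and>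
      (\<forall>p<4. \<forall>q<4. \<sigma> ([i, j, k, l] ! p) < \<sigma> ([i, j, k, l] ! q) \<longleftrightarrow> [a, b, c, d] ! p < [a, b, c, d] ! q))"
    (is "_ \<longleftrightarrow> ?R")
proof -
  have len: "length [a, b, c, d] = 4" by simp
  show ?thesis
  proof
    assume "contains_pattern \<sigma> m [a, b, c, d]"
    then obtain idx where idx: "strict_mono_on {0..<4} idx" "\<forall>p<4. idx p \<in> {1..m}"
      "\<forall>p<4. \<forall>q<4. \<sigma> (idx p) < \<sigma> (idx q) \<longleftrightarrow> [a, b, c, d] ! p < [a, b, c, d] ! q"
      unfolding contains_pattern_def len by blast
    have "idx 0 < idx 1" "idx 1 < idx 2" "idx 2 < idx 3"
      by (rule strict_mono_onD[OF idx(1)]; simp)+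
    moreover have "1 \<le> idx 0" "idx 3 \<le> m" using idx(2) by auto
    moreover have "[idx 0, idx 1, idx 2, idx 3] ! p = idx p" if "p < 4" for p
      using that all_less_4[of "\<lambda>p. [idx 0, idx 1, idx 2, idx 3] ! p = idx p"] by (simp add: numeral_eq_Suc)
    ultimately show ?R
      using idx(3) by (intro exI[of _ "idx 0"] exI[of _ "idx 1"] exI[of _ "idx 2"] exI[of _ "idx 3"]) simp
  next
    assume ?R
    then obtain i j k l where o: "1 \<le> i" "i < j" "j < k" "k < l" "l \<le> m" and
      v: "\<forall>p<4. \<forall>q<4. \<sigma> ([i, j, k, l] ! p) < \<sigma> ([i, j, k, l] ! q) \<longleftrightarrow> [a, b, c, d] ! p < [a, b, c, d] ! q"
      by blast
    have four: "p = 0 \<or> p = 1 \<or> p = 2 \<or> p = 3" if "p < 4" for p :: nat using that by auto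
    have "strict_mono_on {0..<4} ((!) [i, j, k, l])"
    proof (rule strict_mono_onI)
      fix r s :: nat assume "r \<in> {0..<4}" "s \<in> {0..<4}" "r < s"
      then show "[i, j, k, l] ! r < [i, j, k, l] ! s"
        using o four[of r] four[of s] by (auto simp: numeral_eq_Suc)
    qed
    moreover have "\<forall>p<4. [i, j, k, l] ! p \<in> {1..m}"
      using o unfolding all_less_4 by (simp add: numeral_eq_Suc)
    ultimately show "contains_pattern \<sigma> m [a, b, c, d]"
      using v unfolding contains_pattern_def len by blast
  qed
qed

text \<open>The values 1, 2, 3, 4 stand at the third, first, fourth and second position, so the
  sixteen comparisons collapse to one chain.\<close>

lemma contains_2413:
  "contains_pattern \<sigma> m [2,4,1,3] \<longleftrightarrow>
    (\<exists>i j k l. 1 \<le> i \<and> i < j \<and> j < k \<and> k < l \<and> l \<le> m \<and> \<sigma> k < \<sigma> i \<and> \<sigma> i < \<sigma> l \<and> \<sigma> l < \<sigma> j)"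
proof -
  have "(\<forall>p<4. \<forall>q<4. \<sigma> ([i, j, k, l] ! p) < \<sigma> ([i, j, k, l] ! q) \<longleftrightarrow>
      [2,4,1,3] ! p < ([2,4,1,3] ! q :: nat)) \<longleftrightarrow> \<sigma> k < \<sigma> i \<and> \<sigma> i < \<sigma> l \<and> \<sigma> l < \<sigma> j" for i j k l
    unfolding all_less_4 by (auto simp: numeral_eq_Suc)
  then show ?thesis unfolding contains_pattern_4 by (simp only:)
qed

lemma contains_3142:
  "contains_pattern \<sigma> m [3,1,4,2] \<longleftrightarrow>
    (\<exists>i j k l. 1 \<le> i \<and> i < j \<and> j < k \<and> k < l \<and> l \<le> m \<and> \<sigma> j < \<sigma> l \<and> \<sigma> l < \<sigma> i \<and> \<sigma> i < \<sigma> k)"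
proof -
  have "(\<forall>p<4. \<forall>q<4. \<sigma> ([i, j, k, l] ! p) < \<sigma> ([i, j, k, l] ! q) \<longleftrightarrow>
      [3,1,4,2] ! p < ([3,1,4,2] ! q :: nat)) \<longleftrightarrow> \<sigma> j < \<sigma> l \<and> \<sigma> l < \<sigma> i \<and> \<sigma> i < \<sigma> k" for i j k l
    unfolding all_less_4 by (auto simp: numeral_eq_Suc)
  then show ?thesis unfolding contains_pattern_4 by (simp only:)
qed

lemma separable_iff_avoids:
  "separable (map \<sigma> [1..<Suc m]) \<longleftrightarrow> avoids_all \<sigma> m {[2,4,1,3], [3,1,4,2]}"
proof -
  let ?w = "map \<sigma> [1..<Suc m]"
  define Q where "Q i j k l \<longleftrightarrow> \<sigma> k < \<sigma> i \<and> \<sigma> i < \<sigma> l \<and> \<sigma> l < \<sigma> j \<or> \<sigma> j < \<sigma> l \<and> \<sigma> l < \<sigma> i \<and> \<sigma> i < \<sigma> k" for i j k l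
  have len: "length ?w = m" by simp
  have nth: "?w ! i = \<sigma> (Suc i)" if "i < m" for i using that by (simp del: upt_Suc)
  have "\<not> separable ?w \<longleftrightarrow> (\<exists>i j k l. i < j \<and> j < k \<and> k < l \<and> l < m \<and> Q (Suc i) (Suc j) (Suc k) (Suc l))"
    unfolding separable_def not_not len
  proof (intro ex_cong1 conj_cong refl)
    fix i j k l assume *: "i < j" "j < k" "k < l" "l < m"
    then have "?w ! i = \<sigma> (Suc i)" "?w ! j = \<sigma> (Suc j)" "?w ! k = \<sigma> (Suc k)" "?w ! l = \<sigma> (Suc l)"
      by (intro nth; linarith)+
    then show "(?w!k < ?w!i \<and> ?w!i < ?w!l \<and> ?w!l < ?w!j \<or> ?w!j < ?w!l \<and> ?w!l < ?w!i \<and> ?w!i < ?w!k) \<longleftrightarrow>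
      Q (Suc i) (Suc j) (Suc k) (Suc l)"
      unfolding Q_def by (simp only:)
  qed
  \<comment> \<open>List positions start at 0, arguments of \<sigma> at 1.\<close>
  also have "\<dots> \<longleftrightarrow> (\<exists>i j k l. 1 \<le> i \<and> i < j \<and> j < k \<and> k < l \<and> l \<le> m \<and> Q i j k l)"
  proof
    assume "\<exists>i j k l. i < j \<and> j < k \<and> k < l \<and> l < m \<and> Q (Suc i) (Suc j) (Suc k) (Suc l)"
    then obtain i j k l where "i < j" "j < k" "k < l" "l < m" "Q (Suc i) (Suc j) (Suc k) (Suc l)" by blast
    then show "\<exists>i j k l. 1 \<le> i \<and> i < j \<and> j < k \<and> k < l \<and> l \<le> m \<and> Q i j k l"
      by (intro exI[of _ "Suc i"] exI[of _ "Suc j"] exI[of _ "Suc k"] exI[of _ "Suc l"]) simp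
  next
    assume "\<exists>i j k l. 1 \<le> i \<and> i < j \<and> j < k \<and> k < l \<and> l \<le> m \<and> Q i j k l"
    then obtain i j k l where *: "1 \<le> i" "i < j" "j < k" "k < l" "l \<le> m" "Q i j k l" by blast
    then have "i \<noteq> 0" "j \<noteq> 0" "k \<noteq> 0" "l \<noteq> 0" by linarith+
    then obtain i' j' k' l' where "i = Suc i'" "j = Suc j'" "k = Suc k'" "l = Suc l'"
      by (meson not0_implies_Suc)
    with * show "\<exists>i j k l. i < j \<and> j < k \<and> k < l \<and> l < m \<and> Q (Suc i) (Suc j) (Suc k) (Suc l)"
      by (intro exI[of _ i'] exI[of _ j'] exI[of _ k'] exI[of _ l']) simp
  qed
  also have "\<dots> \<longleftrightarrow> contains_pattern \<sigma> m [2,4,1,3] \<or> contains_pattern \<sigma> m [3,1,4,2]"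
    unfolding contains_2413 contains_3142 Q_def by blast
  finally show ?thesis unfolding avoids_all_def by auto
qed

lemma dumont1_iff:
  assumes "\<pi> permutes {1..2*n}"
  shows "\<pi> \<in> dumont1 n \<longleftrightarrow> dumont_word True (map \<pi> [1..<Suc (2*n)])"
proof -
  let ?w = "map \<pi> [1..<Suc (2*n)]"
  have nth: "?w ! i = \<pi> (Suc i)" if "i < 2*n" for i using that by (simp del: upt_Suc)
  \<comment> \<open>Since neighbouring values differ, the two implications of \<open>dumont1\<close>
    amount to one equivalence between odd letters and ascents.\<close>
  have ne: "\<pi> i \<noteq> \<pi> (Suc i)" for i using permutes_inj[OF assms] by (simp add: inj_eq)
  have "dumont_word True ?w \<longleftrightarrow> (\<forall>i<2*n - 1. odd (\<pi> (Suc i)) = (\<pi> (Suc i) < \<pi> (Suc (Suc i)))) \<and>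
      (n \<noteq> 0 \<longrightarrow> odd (\<pi> (2*n)))"
    unfolding dumont_word_nth by (auto simp: nth last_map simp del: upt_Suc)
  also have "\<dots> \<longleftrightarrow> (\<forall>i\<in>{1..2*n}. (even (\<pi> i) \<longrightarrow> i < 2*n \<and> \<pi> i > \<pi> (i+1)) \<and>
        (odd (\<pi> i) \<longrightarrow> i = 2*n \<or> \<pi> i < \<pi> (i+1)))" (is "?L \<longleftrightarrow> ?R")
  proof
    assume L: ?L
    show ?R
    proof
      fix i assume i: "i \<in> {1..2*n}"
      show "(even (\<pi> i) \<longrightarrow> i < 2*n \<and> \<pi> i > \<pi> (i+1)) \<and> (odd (\<pi> i) \<longrightarrow> i = 2*n \<or> \<pi> i < \<pi> (i+1))"
      proof (cases "i = 2*n")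
        case True
        then show ?thesis using L i by auto
      next
        case False
        have "1 \<le> i" "i \<le> 2*n" using i by auto
        with False have "i - 1 < 2*n - 1" "Suc (i-1) = i" by linarith+
        then have "odd (\<pi> i) = (\<pi> i < \<pi> (Suc i))"
          using L[THEN conjunct1, rule_format, of "i-1"] by simp
        then show ?thesis using False i ne[of i] by auto
      qed
    qed
  next
    assume R: ?R
    show ?L
    proof (intro conjI allI impI)
      fix i assume "i < 2*n - 1"
      then have "Suc i \<in> {1..2*n}" "Suc i \<noteq> 2*n" by auto
      then show "odd (\<pi> (Suc i)) = (\<pi> (Suc i) < \<pi> (Suc (Suc i)))"
        using R[rule_format, of "Suc i"] by (metis Suc_eq_plus1 less_asym)
    next
      assume "n \<noteq> 0"
      then show "odd (\<pi> (2*n))" using R[rule_format, of "2*n"] by auto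
    qed
  qed
  finally show ?thesis using assms unfolding dumont1_def by simp
qed

lemma card_dumont1_av:
  "card (dumont1_av n {[2,4,1,3], [3,1,4,2]}) = card (dumont_words True 0 (2*n))"
proof -
  let ?f = "\<lambda>\<pi>. map \<pi> [1..<Suc (2*n)]"
  \<comment> \<open>Outside the positions of the word the inverse must be the identity, as
    \<open>permutes\<close> demands.\<close>
  let ?g = "\<lambda>w i. if i \<in> {1..2*n} then w ! (i - 1) else i"
  have set: "set [1..<Suc (2*n)] = {1..2*n}" by auto
  have mem: "\<pi> \<in> dumont1_av n {[2,4,1,3], [3,1,4,2]} \<longleftrightarrow>
      \<pi> permutes {1..2*n} \<and> dumont_word True (?f \<pi>) \<and> separable (?f \<pi>)" for \<pi>
    unfolding dumont1_av_def separable_iff_avoids using dumont1_iff[of \<pi> n]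
    by (auto simp: dumont1_def simp del: upt_Suc)
  have fg: "?f (?g w) = w" if "length w = 2*n" for w
    using that by (intro nth_equalityI) (auto simp del: upt_Suc)
  have gperm: "?g w permutes {1..2*n}" if w: "w \<in> dumont_words True 0 (2*n)" for w
  proof (rule bij_imp_permutes)
    have len: "length w = 2*n" using length_dumont_words[OF w] .
    have "?g w ` {1..2*n} = set (?f (?g w))" unfolding set_map set ..
    also have "\<dots> = set w" unfolding fg[OF len] ..
    also have "\<dots> = {0<..0 + 2*n}" using w by (simp add: dumont_words_def)
    also have "\<dots> = {1..2*n}" by auto
    finally have "?g w ` {1..2*n} = {1..2*n}" .
    then show "bij_betw (?g w) {1..2*n} {1..2*n}"
      by (intro bij_betw_imageI eq_card_imp_inj_on) simp_all
    show "?g w x = x" if "x \<notin> {1..2*n}" for x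
      using that by (rule if_not_P)
  qed
  have "bij_betw ?f (dumont1_av n {[2,4,1,3], [3,1,4,2]}) (dumont_words True 0 (2*n))"
  proof (rule bij_betw_byWitness[where f' = ?g])
    show "\<forall>\<pi>\<in>dumont1_av n {[2,4,1,3], [3,1,4,2]}. ?g (?f \<pi>) = \<pi>"
    proof (intro ballI ext)
      fix \<pi> i assume "\<pi> \<in> dumont1_av n {[2,4,1,3], [3,1,4,2]}"
      then have "\<pi> permutes {1..2*n}" using mem by blast
      then show "?g (?f \<pi>) i = \<pi> i"
        using permutes_not_in[of \<pi> "{1..2*n}" i] by (auto simp del: upt_Suc)
    qed
    show *: "\<forall>w\<in>dumont_words True 0 (2*n). ?f (?g w) = w"
      using fg length_dumont_words by blast
    show "?f ` dumont1_av n {[2,4,1,3], [3,1,4,2]} \<subseteq> dumont_words True 0 (2*n)"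
    proof (rule image_subsetI)
      fix \<pi> assume "\<pi> \<in> dumont1_av n {[2,4,1,3], [3,1,4,2]}"
      then have p: "\<pi> permutes {1..2*n}" "dumont_word True (?f \<pi>)" "separable (?f \<pi>)"
        using mem by blast+
      have "distinct (?f \<pi>)"
        unfolding distinct_map using permutes_inj_on[OF p(1)] by (simp del: upt_Suc)
      moreover have "set (?f \<pi>) = {0<..0 + 2*n}"
        unfolding set_map set using permutes_image[OF p(1)] by auto
      ultimately show "?f \<pi> \<in> dumont_words True 0 (2*n)"
        using p unfolding dumont_words_def by blast
    qed
    show "?g ` dumont_words True 0 (2*n) \<subseteq> dumont1_av n {[2,4,1,3], [3,1,4,2]}"
    proof (rule image_subsetI)
      fix w assume w: "w \<in> dumont_words True 0 (2*n)"
      then have "dumont_word True w" "separable w" by (auto simp: dumont_words_def)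
      moreover have "?f (?g w) = w" using fg[OF length_dumont_words[OF w]] .
      ultimately have "?g w permutes {1..2*n} \<and> dumont_word True (?f (?g w)) \<and> separable (?f (?g w))"
        using gperm[OF w] by (simp only:)
      then show "?g w \<in> dumont1_av n {[2,4,1,3], [3,1,4,2]}" by (rule mem[THEN iffD2])
    qed
  qed
  then show ?thesis by (rule bij_betw_same_card)
qed

subsection \<open>Solving the recurrences\<close>

lemma catalan_fact: "catalan n = fact (2*n) / (fact n * fact (Suc n))"
  unfolding catalan_def by (subst binomial_fact) (simp_all add: field_simps mult_2)

lemma catalan_Suc: "(real n + 2) * catalan (Suc n) = 2 * (2 * real n + 1) * catalan n"
proof -
  have "fact (2 * Suc n) = (2 * real n + 2) * (2 * real n + 1) * fact (2 * n)"
    by (simp add: algebra_simps)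
  moreover have "fact (Suc (Suc n)) = (real n + 2) * fact (Suc n)"
    by (simp add: algebra_simps)
  moreover have "fact (Suc n) = (real n + 1) * fact n"
    by (simp add: algebra_simps)
  ultimately show ?thesis
    unfolding catalan_fact by (simp only:) (simp add: divide_simps, simp add: algebra_simps)
qed

text \<open>These are the coefficients of \<open>sqrt (1 - 4 x) = 1 - 2 x C(x)\<close>; both sides
  satisfy the same first-order recurrence.\<close>

lemma gbinomial_half_catalan: "(1/2 gchoose Suc n) * (-4) ^ Suc n = - 2 * catalan n"
proof (induction n)
  case 0
  then show ?case by (simp add: catalan_def)
next
  case (Suc n)
  define B B' P :: real where "B = 1/2 gchoose Suc n" and "B' = 1/2 gchoose Suc (Suc n)"
    and "P = (-4) ^ Suc n"
  have IH: "B * P = - 2 * catalan n" using Suc by (simp only: B_def P_def)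
  have "1/2 * B = (real n + 1) * B + (real n + 2) * B'"
    using gbinomial_mult_1[of "1/2 :: real" "Suc n"] unfolding B_def[symmetric] B'_def[symmetric] by (simp add: add_ac)
  then have B': "(real n + 2) * B' = - (2 * real n + 1) / 2 * B"
    by (simp add: field_simps)
  have "(real n + 2) * (B' * (P * -4)) = ((real n + 2) * B') * (P * -4)" by simp
  also have "\<dots> = 2 * (2 * real n + 1) * (B * P)" unfolding B' by (simp add: algebra_simps)
  also have "\<dots> = (real n + 2) * (- 2 * catalan (Suc n))"
    unfolding IH using catalan_Suc[of n] by simp
  finally have "B' * (P * -4) = - 2 * catalan (Suc n)" by simp
  then show ?case by (simp only: B'_def P_def power_Suc mult_ac)
qed

text \<open>By Vandermonde with 1/2 + 1/2 = 1, the square has coefficients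
  \<open>(1 gchoose n) * (-8)^n\<close>, which vanish from \<open>n = 2\<close> on.\<close>

lemma sqrt_fps_square:
  "(Abs_fps (\<lambda>n. (1/2 gchoose n) * (-8) ^ n))\<^sup>2 = (1 - 8 * fps_X :: real fps)"
proof (rule fps_ext)
  fix n
  have "(\<Sum>k=0..n. ((1/2 :: real) gchoose k) * (-8) ^ k * ((1/2 gchoose (n - k)) * (-8) ^ (n - k))) =
      (\<Sum>k=0..n. (1/2 gchoose k) * (1/2 gchoose (n - k))) * (-8) ^ n"
    unfolding sum_distrib_right
    by (rule sum.cong) (simp_all add: mult_ac flip: power_add)
  also have "(\<Sum>k=0..n. ((1/2 :: real) gchoose k) * (1/2 gchoose (n - k))) = 1 gchoose n"
    using gbinomial_Vandermonde[of "1/2 :: real" "1/2" n] by (simp add: atLeast0AtMost)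
  also have "((1::real) gchoose n) * (-8) ^ n = fps_nth (1 - 8 * fps_X :: real fps) n"
  proof (cases "n \<le> 1")
    case True
    then show ?thesis by (cases n) (auto simp: numeral_fps_const)
  next
    case False
    moreover have "((1::real) gchoose n) = 0"
      using False binomial_gbinomial[of 1 n, where ?'a = real] by (simp add: binomial_eq_0)
    ultimately show ?thesis by (simp add: numeral_fps_const fps_X_def)
  qed
  finally show "fps_nth ((Abs_fps (\<lambda>n. (1/2 gchoose n) * (-8) ^ n))\<^sup>2) n = fps_nth (1 - 8 * fps_X :: real fps) n"
    by (simp add: power2_eq_square fps_mult_nth)
qed

section \<open>Generating functions of the two recurrences\<close>

text \<open>The convention \<open>g 0 = 0\<close> turns the sum from 1 into a full Cauchy product;
  nonnegativity serves the convergence of the series of \<open>f\<close>.\<close>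

locale irreducible_recurrence =
  fixes f g :: "nat \<Rightarrow> real"
  assumes f_0: "f 0 = 1" and g_0: "g 0 = 0"
    and f_nonneg: "f n \<ge> 0"
    and f_rec: "n \<ge> 1 \<Longrightarrow> f n = (\<Sum>k=1..n. g k * f (n - k))"
    and g_rec: "n \<ge> 1 \<Longrightarrow> g n = f (n - 1) + (\<Sum>k=1..<n. g k * f (n - k))"
begin

text \<open>Both recurrences at \<open>n + 1\<close> contain the same sum over
  \<open>k \<le> n\<close>; eliminating it leaves a linear relation.\<close>

lemma f_Suc: "f (Suc n) = 2 * g (Suc n) - f n"
proof -
  have "f (Suc n) = g (Suc n) + (\<Sum>k=1..<Suc n. g k * f (Suc n - k))"
    using f_rec[of "Suc n"] f_0 by (simp add: atLeastLessThanSuc_atLeastAtMost)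
  then show ?thesis using g_rec[of "Suc n"] by simp
qed

lemma g_fps: "1 - 4 * Abs_fps g = Abs_fps (\<lambda>n. (1/2 gchoose n) * (-8) ^ n)"
proof -
  let ?F = "Abs_fps f" and ?G = "Abs_fps g" and ?S = "Abs_fps (\<lambda>n. (1/2 gchoose n) * (-8) ^ n) :: real fps"
  have F: "?F = 1 + ?G * ?F"
  proof (rule fps_ext)
    fix n
    have "(\<Sum>k=0..n. g k * f (n - k)) = (\<Sum>k=1..n. g k * f (n - k))"
      using g_0 by (simp add: sum.atLeast_Suc_atMost)
    then show "fps_nth ?F n = fps_nth (1 + ?G * ?F) n"
      using f_0 f_rec[of n] by (cases "n = 0") (simp_all add: fps_mult_nth)
  qed
  have "(1 + fps_X) * ?F = 1 + 2 * ?G"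
  proof (rule fps_ext)
    fix n
    show "fps_nth ((1 + fps_X) * ?F) n = fps_nth (1 + 2 * ?G) n"
      using f_0 g_0 f_Suc by (cases n) (simp_all add: distrib_right numeral_fps_const)
  qed
  \<comment> \<open>Multiplying by \<open>1 - ?G\<close> eliminates \<open>?F\<close>, because
    \<open>?F * (1 - ?G) = 1\<close>.\<close>
  then have "(1 + fps_X) * (?F * (1 - ?G)) = (1 + 2 * ?G) * (1 - ?G)"
    by (simp add: mult.assoc[symmetric])
  moreover have "?F * (1 - ?G) = 1" using F by (simp add: algebra_simps)
  ultimately have "1 + fps_X = (1 + 2 * ?G) * (1 - ?G)" by simp
  then have X: "fps_X = ?G - 2 * ?G * ?G" by (simp add: algebra_simps)
  \<comment> \<open>Completing the square in \<open>fps_X = ?G - 2 * ?G * ?G\<close>.\<close>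
  have "(1 - 4 * ?G)\<^sup>2 = 1 - 8 * fps_X"
    unfolding X by (simp add: power2_eq_square algebra_simps)
  then have "(1 - 4 * ?G)\<^sup>2 = ?S\<^sup>2" by (simp only: sqrt_fps_square)
  then have "1 - 4 * ?G = ?S \<or> 1 - 4 * ?G = - ?S" by (simp only: power2_eq_iff)
  \<comment> \<open>The constant terms are 1 and -1, which selects the sign of the root.\<close>
  moreover have "fps_nth (1 - 4 * ?G) 0 \<noteq> fps_nth (- ?S) 0" using g_0 by (simp add: numeral_fps_const)
  ultimately show ?thesis by metis
qed

lemma g_nth: "(1/2 gchoose n) * (-8) ^ n = (if n = 0 then 1 else 0) - 4 * g n"
  using arg_cong[OF g_fps, of "\<lambda>F. fps_nth F n"] by (simp add: numeral_fps_const)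

text \<open>Writing -8 as (-4) * 2 reduces the coefficients to those of
  \<open>sqrt (1 - 4 x)\<close>, scaled by powers of 2.\<close>

lemma g_catalan: "g (Suc n) = 2 ^ n * catalan n"
proof -
  have "- 4 * g (Suc n) = (1/2 gchoose Suc n) * ((-4) * 2) ^ Suc n"
    using g_nth[of "Suc n"] by simp
  also have "\<dots> = ((1/2 gchoose Suc n) * (-4) ^ Suc n) * 2 ^ Suc n"
    by (simp only: power_mult_distrib mult.assoc)
  also have "\<dots> = - 4 * (2 ^ n * catalan n)"
    unfolding gbinomial_half_catalan by simp
  finally show ?thesis by simp
qed

lemma f_Suc_catalan: "f (Suc n) = 2 ^ Suc n * catalan n - f n"
  unfolding f_Suc g_catalan by simp

lemma g_sums:
  assumes "\<bar>x\<bar> < 1/8"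
  shows "(\<lambda>n. g n * x ^ n) sums ((1 - sqrt (1 - 8 * x)) / 4)"
proof -
  have "(\<lambda>n. (1/2 gchoose n) * (-8 * x) ^ n) sums (1 + (-8 * x)) powr (1/2)"
    using assms by (intro gen_binomial_real) (simp add: abs_mult)
  then have "(\<lambda>n. (1/2 gchoose n) * (-8 * x) ^ n) sums sqrt (1 - 8 * x)"
    using assms by (simp add: powr_half_sqrt)
  moreover have "(\<lambda>n. (if n = 0 then 1 else 0)) sums (1::real)"
    using sums_single[of 0 "\<lambda>_. 1::real"] by simp
  ultimately have "(\<lambda>n. ((if n = 0 then 1 else 0) - (1/2 gchoose n) * (-8 * x) ^ n) / 4) sums ((1 - sqrt (1 - 8 * x)) / 4)"
    by (intro sums_divide sums_diff)
  moreover have "((if n = 0 then 1 else 0) - (1/2 gchoose n) * (-8 * x) ^ n) / 4 = g n * x ^ n" for n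
  proof -
    have "(1/2 gchoose n) * (-8 * x) ^ n = ((1/2 gchoose n) * (-8) ^ n) * x ^ n"
      by (simp only: power_mult_distrib mult.assoc)
    then show ?thesis unfolding g_nth by (auto simp: g_0)
  qed
  ultimately show ?thesis by simp
qed

text \<open>Convergence is settled first, by comparison with \<open>2 * g n\<close>; then
  \<open>F - 1 = 2 G - x F\<close>, the summed form of \<open>f_Suc\<close>, determines the
  value.\<close>

lemma f_sums:
  assumes "\<bar>x\<bar> < 1/8"
  shows "(\<lambda>n. f n * x ^ n) sums ((3 - sqrt (1 - 8 * x)) / (2 * (1 + x)))"
proof -
  have "summable (\<lambda>n. 2 * (g n * \<bar>x\<bar> ^ n))"
    using g_sums[of "\<bar>x\<bar>"] assms by (intro summable_mult) (simp add: sums_iff)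
  \<comment> \<open>The bound fails at \<open>n = 0\<close>, where \<open>f 0 = 1\<close> and
    \<open>g 0 = 0\<close>.\<close>
  moreover have "norm (f n * x ^ n) \<le> 2 * (g n * \<bar>x\<bar> ^ n)" if "n \<ge> 1" for n
  proof -
    have "f n \<le> 2 * g n" using f_Suc[of "n - 1"] f_nonneg[of "n - 1"] that by simp
    then show ?thesis
      using f_nonneg[of n] mult_right_mono[of "f n" "2 * g n" "\<bar>x\<bar> ^ n"] by (simp add: abs_mult power_abs)
  qed
  ultimately have "summable (\<lambda>n. f n * x ^ n)"
    by (rule summable_comparison_test'[where N = 1])
  then obtain F where F: "(\<lambda>n. f n * x ^ n) sums F" by (auto simp: summable_def)
  define G where "G = (1 - sqrt (1 - 8 * x)) / 4"
  have "(\<lambda>n. f (Suc n) * x ^ Suc n) sums (F - 1)"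
    using F f_0 by (subst sums_Suc_iff) simp
  moreover have "(\<lambda>n. g (Suc n) * x ^ Suc n) sums G"
    using g_sums[OF assms] g_0 unfolding G_def by (subst sums_Suc_iff) simp
  then have "(\<lambda>n. 2 * (g (Suc n) * x ^ Suc n) - x * (f n * x ^ n)) sums (2 * G - x * F)"
    using F by (intro sums_diff sums_mult)
  moreover have "2 * (g (Suc n) * x ^ Suc n) - x * (f n * x ^ n) = f (Suc n) * x ^ Suc n" for n
    unfolding f_Suc by (simp add: algebra_simps)
  ultimately have "F - 1 = 2 * G - x * F" using sums_unique2 by simp
  then have "2 * (1 + x) * F = 3 - sqrt (1 - 8 * x)" by (simp add: G_def field_simps)
  moreover have "2 * (1 + x) \<noteq> 0" using assms by auto
  ultimately have "F = (3 - sqrt (1 - 8 * x)) / (2 * (1 + x))"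
    by (metis nonzero_mult_div_cancel_left)
  with F show ?thesis by simp
qed

lemma f_alternating_sum: "f n = (-1) ^ n + (\<Sum>k=1..n. (-1) ^ (n - k) * 2 ^ k * catalan (k - 1))"
proof (induction n)
  case (Suc n)
  have "(\<Sum>k=1..n. (-1) ^ (Suc n - k) * 2 ^ k * catalan (k - 1)) =
      - (\<Sum>k=1..n. (-1) ^ (n - k) * 2 ^ k * catalan (k - 1))"
    unfolding sum_negf[symmetric] by (rule sum.cong) (simp_all add: Suc_diff_le)
  then show ?case using f_Suc_catalan[of n] Suc by simp
qed (simp add: f_0)

end

section \<open>Ballot numbers\<close>

text \<open>For \<open>k < n\<close> this is Bertrand's count of the orders of \<open>n\<close>
  votes against \<open>k\<close> in which the winner leads strictly throughout; for
  \<open>k \<ge> n\<close> the value is 0.\<close>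

definition ballot :: "nat \<Rightarrow> nat \<Rightarrow> real" where
  "ballot n k = real (n - k) / real (n + k) * real (n + k choose n)"

lemma ballot_fact:
  assumes "k \<le> Suc n"
  shows "ballot (Suc n) k = (real n + 1 - real k) * fact (n + k) / (fact (Suc n) * fact k)"
proof -
  have "real (Suc n + k choose Suc n) = fact (Suc n + k) / (fact (Suc n) * fact k)"
    by (subst binomial_fact) simp_all
  also have "(fact (Suc n + k) :: real) = real (Suc n + k) * fact (n + k)" by simp
  finally show ?thesis unfolding ballot_def using assms by (simp add: of_nat_diff)
qed

text \<open>Combinatorially, the last vote counted belongs to one candidate or the other; the
  verification is by factorials.\<close>

lemma ballot_rec:
  assumes "k < Suc n"
  shows "ballot (Suc (Suc n)) (Suc k) = ballot (Suc (Suc n)) k + ballot (Suc n) (Suc k)"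
proof -
  define A B :: real where "A = fact (Suc n)" and "B = fact k"
  define C :: real where "C = fact (Suc n + k)"
  have nz: "A \<noteq> 0" "B \<noteq> 0" by (simp_all add: A_def B_def)
  have "(fact (Suc n + Suc k) :: real) = (real n + real k + 2) * C"
       "(fact (n + Suc k) :: real) = C"
       "(fact (Suc (Suc n)) :: real) = (real n + 2) * A"
       "(fact (Suc k) :: real) = (real k + 1) * B"
    by (simp_all add: A_def B_def C_def algebra_simps)
  then have e1: "ballot (Suc (Suc n)) (Suc k) = (real n + 1 - real k) * ((real n + real k + 2) * C) / (((real n + 2) * A) * ((real k + 1) * B))"
    and e2: "ballot (Suc (Suc n)) k = (real n + 2 - real k) * C / (((real n + 2) * A) * B)"
    and e3: "ballot (Suc n) (Suc k) = (real n - real k) * C / (A * ((real k + 1) * B))"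
    using assms by (simp_all add: ballot_fact A_def B_def C_def del: fact_Suc)
  have "real n + 2 \<noteq> 0" "real k + 1 \<noteq> 0" by linarith+
  then show ?thesis unfolding e1 e2 e3 using nz
    by (simp add: divide_simps) (simp add: algebra_simps)
qed

lemma ballot_diag: "ballot (Suc n) n = catalan n"
  by (subst ballot_fact) (simp_all add: catalan_fact mult_2 mult.commute[of "fact n"])

text \<open>The recurrence of \<open>f_Suc_catalan\<close> for the ballot sums. With
  \<open>S\<close> and \<open>T\<close> the two sums and \<open>D\<close> the last term of
  \<open>S\<close>, a Catalan number by \<open>ballot_diag\<close>, the triangle rule gives
  \<open>S = 1 + 2 (S - D) + (T - 1)\<close>, that is \<open>S = 2 D - T\<close>.\<close>

lemma ballot_sum_rec:
  "(\<Sum>k<Suc (Suc n). ballot (Suc (Suc n)) k * 2 ^ k) =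
     2 ^ Suc (Suc n) * catalan (Suc n) - (\<Sum>k<Suc n. ballot (Suc n) k * 2 ^ k)"
proof -
  let ?S = "\<Sum>k<Suc (Suc n). ballot (Suc (Suc n)) k * 2 ^ k" and ?T = "\<Sum>k<Suc n. ballot (Suc n) k * 2 ^ k"
  have zero: "ballot (Suc m) 0 = 1" for m by (simp add: ballot_def)
  have "?S = 1 + (\<Sum>k<Suc n. ballot (Suc (Suc n)) (Suc k) * 2 ^ Suc k)"
    by (subst sum.lessThan_Suc_shift) (simp add: zero)
  also have "(\<Sum>k<Suc n. ballot (Suc (Suc n)) (Suc k) * 2 ^ Suc k) =
      (\<Sum>k<Suc n. 2 * (ballot (Suc (Suc n)) k * 2 ^ k) + ballot (Suc n) (Suc k) * 2 ^ Suc k)"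
    by (rule sum.cong) (simp_all add: ballot_rec algebra_simps)
  also have "\<dots> = 2 * (\<Sum>k<Suc n. ballot (Suc (Suc n)) k * 2 ^ k) + (\<Sum>k<Suc n. ballot (Suc n) (Suc k) * 2 ^ Suc k)"
    by (simp only: sum.distrib sum_distrib_left)
  also have "(\<Sum>k<Suc n. ballot (Suc (Suc n)) k * 2 ^ k) = ?S - 2 ^ Suc n * catalan (Suc n)"
    by (simp only: sum.lessThan_Suc[of _ "Suc n"] ballot_diag) simp
  also have "(\<Sum>k<Suc n. ballot (Suc n) (Suc k) * 2 ^ Suc k) = (\<Sum>k<Suc (Suc n). ballot (Suc n) k * 2 ^ k) - 1"
    by (simp only: sum.lessThan_Suc_shift[of _ "Suc n"] zero) simp
  \<comment> \<open>The additional term, at \<open>k = Suc n\<close>, is 0.\<close>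
  also have "(\<Sum>k<Suc (Suc n). ballot (Suc n) k * 2 ^ k) = ?T"
    by (simp only: sum.lessThan_Suc[of _ "Suc n"]) (simp add: ballot_def)
  finally show ?thesis by (simp del: sum.lessThan_Suc add: algebra_simps)
qed

lemma (in irreducible_recurrence) f_ballot_sum:
  "f n = (\<Sum>k<n. ballot n k * 2 ^ k) + (if n = 0 then 1 else 0)"
proof (induction n)
  case (Suc n)
  show ?case
  proof (cases n)
    case 0
    then show ?thesis using f_Suc_catalan[of 0] f_0 by (simp add: ballot_def catalan_def)
  next
    case (Suc m)
    then show ?thesis using f_Suc_catalan[of n] ballot_sum_rec[of m] Suc.IH by simp
  qed
qed (simp add: f_0)

section \<open>Closed forms\<close>

text \<open>The value at 0 is set by hand: the empty word counts as sum-irreducible, so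
  \<open>irreducible_words 0\<close> has one element.\<close>

interpretation dumont: irreducible_recurrence
  "\<lambda>n. real (card (dumont1_av n {[2,4,1,3], [3,1,4,2]}))"
  "\<lambda>n. if n = 0 then 0 else real (card (irreducible_words n))"
proof
  let ?f = "\<lambda>n. real (card (dumont1_av n {[2,4,1,3], [3,1,4,2]}))"
  have "dumont_words True 0 0 = {[]}"
    by (auto simp: dumont_words_def separable_def)
  then show "?f 0 = 1" unfolding card_dumont1_av by simp
  fix n :: nat
  assume "1 \<le> n"
  then show "?f n = (\<Sum>k=1..n. (if k = 0 then 0 else real (card (irreducible_words k))) * ?f (n - k))"
    unfolding card_dumont1_av by (simp add: card_dumont_words_rec)
  show "(if n = 0 then 0 else real (card (irreducible_words n))) =
      ?f (n - 1) + (\<Sum>k=1..<n. (if k = 0 then 0 else real (card (irreducible_words k))) * ?f (n - k))"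
    unfolding card_dumont1_av using \<open>1 \<le> n\<close> by (simp add: card_irreducible_words_rec)
qed simp_all

text \<open>The argument is chosen so that the discriminant \<open>1 - 4 y\<close> becomes
  \<open>(1 - 8 x) / 9\<close>. The factor has to be 2/3, not 1/3: at \<open>x = 0\<close> the left
  side is 1 while \<open>C(2/9) = 3/2\<close>.\<close>

lemma gf_eq_catalan_gf:
  assumes "\<bar>x\<bar> < 1/8"
  shows "(3 - sqrt (1 - 8*x)) / (2*(1+x)) = 2/3 * catalan_gf (2*(1+x)/9)"
proof -
  have "1 - 4 * (2*(1+x)/9) = (1 - 8*x) / 3\<^sup>2" by (simp add: field_simps)
  then have "sqrt (1 - 4 * (2*(1+x)/9)) = sqrt (1 - 8*x) / 3"
    by (simp only: real_sqrt_divide real_sqrt_abs abs_numeral)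
  moreover have nz: "1 + x \<noteq> 0" using assms by auto
  ultimately have "catalan_gf (2*(1+x)/9) = (1 - sqrt (1 - 8*x) / 3) / (2 * (2*(1+x)/9))"
    by (simp only: catalan_gf_def) simp
  then show ?thesis using nz by (simp add: divide_simps) (simp add: algebra_simps)
qed

lemma sqrt_eq_catalan_gf: "sqrt (1 - 8*x) = 1 - 4 * (x * catalan_gf (2*x))"
  by (simp add: catalan_gf_def field_simps)

text \<open>Rationalizing the numerator: with \<open>s\<close> the root,
  \<open>(3 - s) * (3 + s) = 8 * (1 + x)\<close>, and \<open>3 + s\<close> is positive.\<close>

lemma gf_eq_reciprocal:
  assumes "\<bar>x\<bar> < 1/8"
  shows "(3 - sqrt (1 - 8*x)) / (2*(1+x)) = 1 / (1 - x * catalan_gf (2*x))"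
proof -
  let ?s = "sqrt (1 - 8*x)"
  have "?s\<^sup>2 = 1 - 8*x" "?s \<ge> 0" using assms by auto
  then have "(3 - ?s) * (3 + ?s) = 4 * (2*(1+x))"
    by (simp add: power2_eq_square algebra_simps)
  moreover have "2*(1+x) \<noteq> 0" using assms by auto
  moreover have "3 + ?s \<noteq> 0" using \<open>?s \<ge> 0\<close> by linarith
  ultimately have "(3 - ?s) / (2*(1+x)) = 4 / (3 + ?s)" by (metis frac_eq_eq)
  moreover have "1 - x * catalan_gf (2*x) = (3 + ?s) / 4" unfolding sqrt_eq_catalan_gf by simp
  ultimately show ?thesis by (simp only:) simp
qed

text \<open>The generating function is read as a real power series up to the branch point 1/8 of
  \<open>sqrt (1 - 8 x)\<close>; the apparent pole at -1 lies outside this interval.\<close>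

theorem theorem3p11:
  shows "(\<forall>x::real. \<bar>x\<bar> < 1/8 \<longrightarrow>
            (\<lambda>n. real (card (dumont1_av n {[2,4,1,3], [3,1,4,2]})) * x ^ n)
               sums ((3 - sqrt (1 - 8*x)) / (2*(1+x))) \<and>
            (3 - sqrt (1 - 8*x)) / (2*(1+x)) = 2/3 * catalan_gf (2*(1+x)/9) \<and>
            (3 - sqrt (1 - 8*x)) / (2*(1+x)) = (1 + 2*x*catalan_gf (2*x)) / (1+x) \<and>
            (3 - sqrt (1 - 8*x)) / (2*(1+x)) = 1 / (1 - x * catalan_gf (2*x)))
         \<and> (\<forall>n::nat.
            real (card (dumont1_av n {[2,4,1,3], [3,1,4,2]}))
              = (-1)^n + (\<Sum>k=1..n. (-1)^(n-k) * 2^k * catalan (k-1)) \<and>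
            real (card (dumont1_av n {[2,4,1,3], [3,1,4,2]}))
              = (\<Sum>k<n. (real (n-k) / real (n+k)) * real (n+k choose n) * 2^k)
                + (if n = 0 then 1 else 0))"
proof (intro conjI allI impI)
  fix x :: real
  assume x: "\<bar>x\<bar> < 1/8"
  show "(\<lambda>n. real (card (dumont1_av n {[2,4,1,3], [3,1,4,2]})) * x ^ n)
      sums ((3 - sqrt (1 - 8*x)) / (2*(1+x)))"
    using x by (rule dumont.f_sums)
  show "(3 - sqrt (1 - 8*x)) / (2*(1+x)) = 2/3 * catalan_gf (2*(1+x)/9)"
    using x by (rule gf_eq_catalan_gf)
  show "(3 - sqrt (1 - 8*x)) / (2*(1+x)) = (1 + 2*x*catalan_gf (2*x)) / (1+x)"
    unfolding sqrt_eq_catalan_gf by (simp add: divide_simps) (simp add: algebra_simps)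
  show "(3 - sqrt (1 - 8*x)) / (2*(1+x)) = 1 / (1 - x * catalan_gf (2*x))"
    using x by (rule gf_eq_reciprocal)
next
  fix n :: nat
  show "real (card (dumont1_av n {[2,4,1,3], [3,1,4,2]}))
      = (-1)^n + (\<Sum>k=1..n. (-1)^(n-k) * 2^k * catalan (k-1))"
    by (rule dumont.f_alternating_sum)
  show "real (card (dumont1_av n {[2,4,1,3], [3,1,4,2]}))
      = (\<Sum>k<n. (real (n-k) / real (n+k)) * real (n+k choose n) * 2^k) + (if n = 0 then 1 else 0)"
    using dumont.f_ballot_sum[of n] by (simp only: ballot_def)
qed

end
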